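(* The algorithm given in the context is a linearizable implementation of a collection of $m$ LL/SC objects (with sequential specification as given in the context), with $lin(c)$ as the linearization point of each call $c$. That is, for every execution, ordering by $lin(c)$ all directly made calls $c$ for which $lin(c)$ is defined (calls with undefined $lin(c)$ and CL calls invoked internally by other methods are omitted) yields a linearization of the execution.
   Context: Model. $n$ asynchronous processes communicate by atomic operations (steps) on shared objects. A CAS object supports $\mathrm{Read}()$ and $\mathrm{CAS}(old,new)$, which, if the current value equals $old$, writes $new$ and returns True (success), and otherwise returns False and changes nothing (failure). A FAID object stores an integer in a range $\{0,\dots,M-1\}$ and supports $\mathrm{Read}()$, $\mathrm{FAI}()$, $\mathrm{FAD}()$; each returns the current value, and FAI/FAD additionally increment/decrement it (leaving the range would be an overflow, with unspecified effect). Each process performs method calls one at a time; it is idle if it has no pending call. Steps are arbitrarily interleaved. A point is the time of an event of the execution. Local computation takes no time; a call (also an internal one) responds at the point of its last shared memory step (or at its invocation if it has none). Data. Constants: $U$ = set of values, $m$ objects, $n$ processes, bound $k\ge 1$. Shared: CAS objects $L[i]$, $1\le i\le m$, storing pairs (val, tag) in $U\times\{0,\dots,2k\}$, initially $(u_i,0)$ with given $u_i\in U$; FAID objects $C[i]$, $1\le i\le m$, range $\{0,\dots,n\}$, initially $0$; FAID objects $R[g]$, $1\le g\le 2k$, range $\{0,\dots,k\}$, initially $0$. Each process has a local persistent dictionary $d$ with keys $1,\dots,m$ and values in $U\times\{0,\dots,2k\}$ or $\bot$ (initially all $\bot$). $x.\mathrm{val}$, $x.\mathrm{tag}$ are the components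 of a pair $x$. Algorithm ($i\in\{1,\dots,m\}$, $u\in U$). LL(i): (L1) if $d[i]\ne\bot$, call CL(i). (L2) $C[i].\mathrm{FAI}()$. (L3) $(val,tag)\gets L[i].\mathrm{Read}()$. (L4) $d[i]\gets(val,tag)$. (L5) if $tag=0$ return $val$. (L6) $R[tag].\mathrm{FAI}()$. (L7) $(val',tag')\gets L[i].\mathrm{Read}()$. (L8) if $(val,tag)=(val',tag')$ return $val'$. (L9) if $tag'=0$: $R[tag].\mathrm{FAD}()$; $d[i]\gets(val',0)$; return $val'$. (L10) call CL(i). (L11) return $val$. SC(i,u): (S1) if $d[i]=\bot$ return False. (S2) repeat: $tag'\gets$ uniform independent random sample from $\{1,\dots,2k\}$; until $R[tag'].\mathrm{Read}()=0$. (S3) $result\gets L[i].\mathrm{CAS}(d[i],(u,tag'))$. (S4) if $result$ = False, $result\gets L[i].\mathrm{CAS}((d[i].\mathrm{val},0),(u,tag'))$. (S5) call CL(i). (S6) return $result$. CL(i): (K1) if $d[i]=\bot$ return. (K2) if $d[i].\mathrm{tag}\ne0$, $R[d[i].\mathrm{tag}].\mathrm{FAD}()$. (K3) $d[i]\gets\bot$. (K4) if $C[i].\mathrm{FAD}()>1$ return. (K5) $(val,tag)\gets L[i].\mathrm{Read}()$. (K6) if $tag=0$ return. (K7) $R[tag].\mathrm{FAI}()$. (K8) if $L[i].\mathrm{Read}()=(val,tag)$ then (K9) if $C[i].\mathrm{Read}()=0$ then (K10) $L[i].\mathrm{CAS}((val,tag),(val,0))$. (K11) $R[tag].\mathrm{FAD}()$.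 Read(i): return $L[i].\mathrm{Read}().\mathrm{val}$. VL(i): (V1) if $d[i]=\bot$ return False. (V2) if $L[i].\mathrm{Read}().\mathrm{tag}\in\{d[i].\mathrm{tag},0\}$ return True. (V3) call CL(i). (V4) return False. Outstanding LL. A process begins to have an outstanding LL(i) when it invokes LL(i), and ceases to have it when it completes an SC(i,·), a CL(i), or a VL(i) returning False (only calls made directly, not internal CL calls, count). A process has at most one outstanding LL per object. Standing assumption: at every point, the total number of outstanding LL operations over all processes and objects is at most $k$. The claim is for every execution, whatever the interleaving and the random outcomes. Sequential specification. The state of one LL/SC object is $(v,(\ell_1,\dots,\ell_n))$ with value $v\in U$ and bits $\ell_p$, initially all $0$ (for object $i$ the initial value is $u_i$). Read returns $v$. LL by process $p$ sets $\ell_p$ to $1$ and returns $v$. SC(x) by $p$: if $\ell_p=1$ the state becomes $(x,(0,\dots,0))$ and True is returned; if $\ell_p=0$ the state is unchanged and False is returned. CL by $p$ sets $\ell_p$ to $0$ and returns nothing. VL by $p$ returns True iff $\ell_p=1$. The collection's state is the product of $m$ such states, and the argument $i$ of an operation selects the object affected. Linearization. A linearization of an execution $E$ is a sequential execution, consistent with the sequential specification, containing all operations that have responded in $E$ and some operations pending at the end of $E$, in which arguments and (where applicable) response values match those in $E$, and in which $a$ precedes $b$ whenever $a$ responds before $b$ is invoked in $E$. Function $lin$. For an LL call $c$: if it responds in L5 or L11, $lin(c)$ is its execution of L3; if it responds in L8 or L9, $lin(c)$ is its execution of L7. For an SC call: its invocation if it returns in S1; otherwise its last CAS, i.e. S3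 if that CAS succeeds and S4 otherwise. For a CL call: its invocation. For a Read call: its only step. For a VL call: its invocation if it returns in V1, otherwise its execution of V2. $lin(c)$ is undefined for pending LL calls and for other pending calls for which the step corresponding to $lin(c)$ has not yet been executed. *)

theory Defs
  imports Main "HOL-Library.Extended_Nat"
begin

section \<open>Operations and sequential specification\<close>

text \<open>Values are the elements of the type \<^typ>\<open>'u\<close>; objects are numbered
  \<open>1..m\<close> and processes \<open>1..n\<close>.\<close>

datatype 'u op = LL nat | SC nat 'u | CL nat | Read nat | VL nat

fun obj :: "'u op \<Rightarrow> nat" where
  "obj (LL i) = i"
| "obj (SC i u) = i"
| "obj (CL i) = i"
| "obj (Read i) = i"
| "obj (VL i) = i"

datatype 'u resp = Val 'u | Bool bool | Nothing

text \<open>One LL/SC object: its value and one bit for each process.\<close>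

type_synonym 'u llsc = "'u \<times> (nat \<Rightarrow> bool)"

fun spec_step :: "nat \<Rightarrow> 'u op \<Rightarrow> (nat \<Rightarrow> 'u llsc) \<Rightarrow> (nat \<Rightarrow> 'u llsc) \<times> 'u resp" where
  "spec_step p (Read i) s = (s, Val (fst (s i)))"
| "spec_step p (LL i) s = (s(i := (fst (s i), (snd (s i))(p := True))), Val (fst (s i)))"
| "spec_step p (SC i x) s =
     (if snd (s i) p then (s(i := (x, \<lambda>_. False)), Bool True) else (s, Bool False))"
| "spec_step p (CL i) s = (s(i := (fst (s i), (snd (s i))(p := False))), Nothing)"
| "spec_step p (VL i) s = (s, Bool (snd (s i) p))"

text \<open>A finite or infinite sequential execution is given by its length and, for each position,
  the process, the operation and the response.\<close>

definition consistent_with_spec ::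
  "(nat \<Rightarrow> 'u) \<Rightarrow> enat \<Rightarrow> (nat \<Rightarrow> nat \<times> 'u op \<times> 'u resp) \<Rightarrow> bool" where
  "consistent_with_spec u N H \<longleftrightarrow>
     (\<exists>s. s 0 = (\<lambda>i. (u i, \<lambda>_. False)) \<and>
          (\<forall>j. enat j < N \<longrightarrow> (case H j of (p, a, r) \<Rightarrow> spec_step p a (s j) = (s (Suc j), r))))"


section \<open>Shared objects\<close>

text \<open>\<open>fai N x x' r\<close>: a FAI on a FAID object with range \<open>{0..N}\<close> and value \<open>x\<close> may
  leave the value \<open>x'\<close> and return \<open>r\<close>. In case of an overflow nothing is
  specified, so every outcome is possible. Similarly for \<open>fad\<close>.
  The objects \<open>C[i]\<close> have range \<open>{0..n}\<close> and the objects \<open>R[g]\<close> have range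
  \<open>{0..k}\<close>.\<close>

definition fai :: "nat \<Rightarrow> nat \<Rightarrow> nat \<Rightarrow> nat \<Rightarrow> bool" where
  "fai N x x' r \<longleftrightarrow> (x < N \<longrightarrow> x' = x + 1 \<and> r = x)"

definition fad :: "nat \<Rightarrow> nat \<Rightarrow> nat \<Rightarrow> nat \<Rightarrow> bool" where
  "fad N x x' r \<longleftrightarrow> (0 < x \<and> x \<le> N \<longrightarrow> x' = x - 1 \<and> r = x)"

definition cas :: "'a \<Rightarrow> 'a \<Rightarrow> 'a \<Rightarrow> 'a \<times> bool" where
  "cas x old new = (if x = old then (new, True) else (x, False))"

type_synonym 'u tagged = "'u \<times> nat"

record 'u mem =
  objL :: "nat \<Rightarrow> 'u tagged"
  objC :: "nat \<Rightarrow> nat"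
  objR :: "nat \<Rightarrow> nat"

datatype 'u mem_resp = Pair_resp "'u tagged" | Num_resp nat | Bool_resp bool


section \<open>The algorithm\<close>

type_synonym 'u dict = "nat \<Rightarrow> 'u tagged option"

text \<open>Where the method CL has been called, with the local variables of the caller that are
  still needed when CL returns.\<close>

datatype 'u caller = Direct | From_L1 | From_L10 'u | From_S5 bool | From_V3

text \<open>Control states: the line with the next shared memory step and the values of the local
  variables that are still needed. Control states between two shared memory steps do not occur,
  as local computation takes no time. The arguments of \<open>L6\<close>, \<open>L7\<close> are
  \<open>val\<close>, \<open>tag\<close>, those of \<open>L9\<close> are \<open>val\<close>,
  \<open>tag\<close>, \<open>val'\<close>; \<open>S3\<close> and \<open>S4\<close> have the sampled
  tag, and \<open>K7\<close> to \<open>K11\<close> have \<open>val\<close>, \<open>tag\<close>.\<close>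

datatype 'u pc =
  is_L2: L2 | is_L3: L3 | is_L6: L6 'u nat | is_L7: L7 'u nat | is_L9: L9 'u nat 'u
| is_S2: S2 | is_S3: S3 nat | is_S4: S4 nat
| is_K2: K2 "'u caller" | is_K4: K4 "'u caller" | is_K5: K5 "'u caller"
| is_K7: K7 "'u caller" 'u nat | is_K8: K8 "'u caller" 'u nat | is_K9: K9 "'u caller" 'u nat
| is_K10: K10 "'u caller" 'u nat | is_K11: K11 "'u caller" 'u nat
| is_R1: R1
| is_V2: V2

text \<open>The line in which a directly made call responds (not distinguished for CL).\<close>

datatype exit =
  ret_L5 | ret_L8 | ret_L9 | ret_L11 | ret_S1 | ret_S6 | ret_CL | ret_Read | ret_V1 | ret_V2 | ret_V4

datatype 'u continue = Goto "'u pc" | Return exit "'u resp"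

fun return_CL :: "'u caller \<Rightarrow> 'u continue" where
  "return_CL Direct = Return ret_CL Nothing"
| "return_CL From_L1 = Goto L2"
| "return_CL (From_L10 v) = Return ret_L11 (Val v)"
| "return_CL (From_S5 result) = Return ret_S6 (Bool result)"
| "return_CL From_V3 = Return ret_V4 (Bool False)"

text \<open>Lines K1 to K3, up to the first shared memory step of CL.\<close>

definition call_CL :: "nat \<Rightarrow> 'u caller \<Rightarrow> 'u dict \<Rightarrow> 'u dict \<times> 'u continue" where
  "call_CL i b d =
     (case d i of
        None \<Rightarrow> (d, return_CL b)
      | Some (v, t) \<Rightarrow> if t \<noteq> 0 then (d, Goto (K2 b)) else (d(i := None), Goto (K4 b)))"

text \<open>The local computation from the invocation of a method to its first shared memory step.\<close>

fun start :: "'u op \<Rightarrow> 'u dict \<Rightarrow> 'u dict \<times> 'u continue" where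
  "start (LL i) d = (if d i \<noteq> None then call_CL i From_L1 d else (d, Goto L2))"
| "start (SC i u) d = (if d i = None then (d, Return ret_S1 (Bool False)) else (d, Goto S2))"
| "start (CL i) d = call_CL i Direct d"
| "start (Read i) d = (d, Goto R1)"
| "start (VL i) d = (if d i = None then (d, Return ret_V1 (Bool False)) else (d, Goto V2))"

text \<open>\<open>step n k a c d M y d' M' e\<close>: a process that executes a call of \<open>a\<close> and
  has control state \<open>c\<close> and dictionary \<open>d\<close> can make a shared memory step with
  response \<open>y\<close> that changes the memory from \<open>M\<close> to \<open>M'\<close>, followed by
  local computation that ends with dictionary \<open>d'\<close> and continuation \<open>e\<close>.
  The sample in S2 is an arbitrary choice; drawing it at the time of the subsequent read of
  \<open>R\<close> makes no difference because sampling is local.\<close>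

inductive step ::
  "nat \<Rightarrow> nat \<Rightarrow> 'u op \<Rightarrow> 'u pc \<Rightarrow> 'u dict \<Rightarrow> 'u mem \<Rightarrow> 'u mem_resp \<Rightarrow>
   'u dict \<Rightarrow> 'u mem \<Rightarrow> 'u continue \<Rightarrow> bool"
  for n k :: nat where
  step_L2: "fai n (objC M i) x r \<Longrightarrow>
    step n k (LL i) L2 d M (Num_resp r) d (M\<lparr>objC := (objC M)(i := x)\<rparr>) (Goto L3)"
| step_L3: "objL M i = (v, t) \<Longrightarrow>
    step n k (LL i) L3 d M (Pair_resp (v, t)) (d(i := Some (v, t))) M
      (if t = 0 then Return ret_L5 (Val v) else Goto (L6 v t))"
| step_L6: "fai k (objR M t) x r \<Longrightarrow>
    step n k (LL i) (L6 v t) d M (Num_resp r) d (M\<lparr>objR := (objR M)(t := x)\<rparr>) (Goto (L7 v t))"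
| step_L7_same: "objL M i = (v', t') \<Longrightarrow> (v, t) = (v', t') \<Longrightarrow>
    step n k (LL i) (L7 v t) d M (Pair_resp (v', t')) d M (Return ret_L8 (Val v'))"
| step_L7_untagged: "objL M i = (v', t') \<Longrightarrow> (v, t) \<noteq> (v', t') \<Longrightarrow> t' = 0 \<Longrightarrow>
    step n k (LL i) (L7 v t) d M (Pair_resp (v', t')) d M (Goto (L9 v t v'))"
| step_L7_tagged: "objL M i = (v', t') \<Longrightarrow> (v, t) \<noteq> (v', t') \<Longrightarrow> t' \<noteq> 0 \<Longrightarrow>
    call_CL i (From_L10 v) d = (d', e) \<Longrightarrow>
    step n k (LL i) (L7 v t) d M (Pair_resp (v', t')) d' M e"
| step_L9: "fad k (objR M t) x r \<Longrightarrow>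
    step n k (LL i) (L9 v t v') d M (Num_resp r) (d(i := Some (v', 0)))
      (M\<lparr>objR := (objR M)(t := x)\<rparr>) (Return ret_L9 (Val v'))"

| step_S2: "g \<in> {1..2 * k} \<Longrightarrow>
    step n k (SC i u) S2 d M (Num_resp (objR M g)) d M
      (if objR M g = 0 then Goto (S3 g) else Goto S2)"
| step_S3_success: "cas (objL M i) (the (d i)) (u, g) = (x, True) \<Longrightarrow>
    call_CL i (From_S5 True) d = (d', e) \<Longrightarrow>
    step n k (SC i u) (S3 g) d M (Bool_resp True) d' (M\<lparr>objL := (objL M)(i := x)\<rparr>) e"
| step_S3_failure: "cas (objL M i) (the (d i)) (u, g) = (x, False) \<Longrightarrow>
    step n k (SC i u) (S3 g) d M (Bool_resp False) d (M\<lparr>objL := (objL M)(i := x)\<rparr>) (Goto (S4 g))"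
| step_S4: "cas (objL M i) (fst (the (d i)), 0) (u, g) = (x, result) \<Longrightarrow>
    call_CL i (From_S5 result) d = (d', e) \<Longrightarrow>
    step n k (SC i u) (S4 g) d M (Bool_resp result) d' (M\<lparr>objL := (objL M)(i := x)\<rparr>) e"

| step_K2: "i = obj a \<Longrightarrow> t = snd (the (d i)) \<Longrightarrow> fad k (objR M t) x r \<Longrightarrow>
    step n k a (K2 b) d M (Num_resp r) (d(i := None)) (M\<lparr>objR := (objR M)(t := x)\<rparr>) (Goto (K4 b))"
| step_K4: "i = obj a \<Longrightarrow> fad n (objC M i) x r \<Longrightarrow>
    step n k a (K4 b) d M (Num_resp r) d (M\<lparr>objC := (objC M)(i := x)\<rparr>)
      (if r > 1 then return_CL b else Goto (K5 b))"
| step_K5: "objL M (obj a) = (v, t) \<Longrightarrow>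
    step n k a (K5 b) d M (Pair_resp (v, t)) d M (if t = 0 then return_CL b else Goto (K7 b v t))"
| step_K7: "fai k (objR M t) x r \<Longrightarrow>
    step n k a (K7 b v t) d M (Num_resp r) d (M\<lparr>objR := (objR M)(t := x)\<rparr>) (Goto (K8 b v t))"
| step_K8: "objL M (obj a) = y \<Longrightarrow>
    step n k a (K8 b v t) d M (Pair_resp y) d M
      (if y = (v, t) then Goto (K9 b v t) else Goto (K11 b v t))"
| step_K9: "objC M (obj a) = r \<Longrightarrow>
    step n k a (K9 b v t) d M (Num_resp r) d M
      (if r = 0 then Goto (K10 b v t) else Goto (K11 b v t))"
| step_K10: "i = obj a \<Longrightarrow> cas (objL M i) (v, t) (v, 0) = (x, result) \<Longrightarrow>
    step n k a (K10 b v t) d M (Bool_resp result) d (M\<lparr>objL := (objL M)(i := x)\<rparr>)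
      (Goto (K11 b v t))"
| step_K11: "fad k (objR M t) x r \<Longrightarrow>
    step n k a (K11 b v t) d M (Num_resp r) d (M\<lparr>objR := (objR M)(t := x)\<rparr>) (return_CL b)"

| step_R1: "objL M i = (v, t) \<Longrightarrow>
    step n k (Read i) R1 d M (Pair_resp (v, t)) d M (Return ret_Read (Val v))"

| step_V2_true: "objL M i = (v, t) \<Longrightarrow> t \<in> {snd (the (d i)), 0} \<Longrightarrow>
    step n k (VL i) V2 d M (Pair_resp (v, t)) d M (Return ret_V2 (Bool True))"
| step_V2_false: "objL M i = (v, t) \<Longrightarrow> t \<notin> {snd (the (d i)), 0} \<Longrightarrow>
    call_CL i From_V3 d = (d', e) \<Longrightarrow>
    step n k (VL i) V2 d M (Pair_resp (v, t)) d' M e"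


section \<open>Executions\<close>

text \<open>A process is idle if its status is \<^const>\<open>None\<close>; otherwise the status consists
  of the directly made pending call and the control state.\<close>

record 'u config =
  mem :: "'u mem"
  dict :: "nat \<Rightarrow> 'u dict"
  status :: "nat \<Rightarrow> ('u op \<times> 'u pc) option"

definition initial :: "(nat \<Rightarrow> 'u) \<Rightarrow> 'u config" where
  "initial u =
     \<lparr>mem = \<lparr>objL = (\<lambda>i. (u i, 0)), objC = (\<lambda>_. 0), objR = (\<lambda>_. 0)\<rparr>,
      dict = (\<lambda>_ _. None), status = (\<lambda>_. None)\<rparr>"

datatype 'u action = Invoke | Step "'u pc" "'u mem_resp"

text \<open>An event is an invocation or a shared memory step. It belongs to a directly made call of
  operation \<open>oper\<close> by process \<open>proc\<close>. The outcome is present iff this call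
  responds at this point.\<close>

record 'u event =
  proc :: nat
  oper :: "'u op"
  act :: "'u action"
  outcome :: "(exit \<times> 'u resp) option"

fun outcome_of :: "'u continue \<Rightarrow> (exit \<times> 'u resp) option" where
  "outcome_of (Goto c) = None"
| "outcome_of (Return x r) = Some (x, r)"

fun status_of :: "'u op \<Rightarrow> 'u continue \<Rightarrow> ('u op \<times> 'u pc) option" where
  "status_of a (Goto c) = Some (a, c)"
| "status_of a (Return x r) = None"

inductive transition ::
  "nat \<Rightarrow> nat \<Rightarrow> nat \<Rightarrow> 'u config \<Rightarrow> 'u event \<Rightarrow> 'u config \<Rightarrow> bool"
  for n m k :: nat where
  invocation: "p \<in> {1..n} \<Longrightarrow> obj a \<in> {1..m} \<Longrightarrow> status S p = None \<Longrightarrow>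
    start a (dict S p) = (d, e) \<Longrightarrow>
    transition n m k S
      \<lparr>proc = p, oper = a, act = Invoke, outcome = outcome_of e\<rparr>
      (S\<lparr>dict := (dict S)(p := d), status := (status S)(p := status_of a e)\<rparr>)"
| shared_step: "status S p = Some (a, c) \<Longrightarrow>
    step n k a c (dict S p) (mem S) y d M e \<Longrightarrow>
    transition n m k S
      \<lparr>proc = p, oper = a, act = Step c y, outcome = outcome_of e\<rparr>
      \<lparr>mem = M, dict = (dict S)(p := d), status = (status S)(p := status_of a e)\<rparr>"

text \<open>The points of an execution are the numbers \<open>t\<close> smaller than its length, which is
  infinite for infinite executions.\<close>

record 'u exec =
  len :: enat
  ev :: "nat \<Rightarrow> 'u event"

definition execution :: "nat \<Rightarrow> nat \<Rightarrow> nat \<Rightarrow> (nat \<Rightarrow> 'u) \<Rightarrow> 'u exec \<Rightarrow> bool" where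
  "execution n m k u E \<longleftrightarrow>
     (\<exists>S. S 0 = initial u \<and> (\<forall>t. enat t < len E \<longrightarrow> transition n m k (S t) (ev E t) (S (Suc t))))"

text \<open>Only directly made calls have outcomes, so internal calls of CL do not count here.\<close>

definition ends_LL :: "nat \<Rightarrow> nat \<Rightarrow> 'u event \<Rightarrow> bool" where
  "ends_LL p i e \<longleftrightarrow> proc e = p \<and>
     (\<exists>x r. outcome e = Some (x, r) \<and>
        ((\<exists>u. oper e = SC i u) \<or> oper e = CL i \<or> oper e = VL i \<and> r = Bool False))"

definition outstanding :: "'u exec \<Rightarrow> nat \<Rightarrow> (nat \<times> nat) set" where
  "outstanding E t =
     {(p, i). \<exists>s\<le>t. proc (ev E s) = p \<and> oper (ev E s) = LL i \<and> act (ev E s) = Invoke \<and>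
                \<not> (\<exists>r. s < r \<and> r \<le> t \<and> ends_LL p i (ev E r))}"


section \<open>Linearization\<close>

text \<open>A directly made call is identified with the point of its invocation. An event belongs to
  the most recently invoked call of the process.\<close>

definition calls :: "'u exec \<Rightarrow> nat set" where
  "calls E = {c. enat c < len E \<and> act (ev E c) = Invoke}"

definition event_of :: "'u exec \<Rightarrow> nat \<Rightarrow> nat \<Rightarrow> bool" where
  "event_of E c t \<longleftrightarrow> enat t < len E \<and> c \<le> t \<and> proc (ev E t) = proc (ev E c) \<and>
     (\<forall>s. c < s \<and> s \<le> t \<and> proc (ev E s) = proc (ev E c) \<longrightarrow> act (ev E s) \<noteq> Invoke)"

definition first_point :: "(nat \<Rightarrow> bool) \<Rightarrow> nat option" where
  "first_point P = (if \<exists>t. P t then Some (LEAST t. P t) else None)"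

definition response_point :: "'u exec \<Rightarrow> nat \<Rightarrow> nat option" where
  "response_point E c = first_point (\<lambda>t. event_of E c t \<and> outcome (ev E t) \<noteq> None)"

definition response :: "'u exec \<Rightarrow> nat \<Rightarrow> (exit \<times> 'u resp) option" where
  "response E c = (case response_point E c of None \<Rightarrow> None | Some t \<Rightarrow> outcome (ev E t))"

text \<open>The point where call \<open>c\<close> makes a step described by \<open>P\<close>. It is used only
  for lines that a call executes at most once.\<close>

definition step_point :: "'u exec \<Rightarrow> nat \<Rightarrow> ('u pc \<Rightarrow> 'u mem_resp \<Rightarrow> bool) \<Rightarrow> nat option" where
  "step_point E c P =
     first_point (\<lambda>t. event_of E c t \<and> (\<exists>l y. act (ev E t) = Step l y \<and> P l y))"

definition lin :: "'u exec \<Rightarrow> nat \<Rightarrow> nat option" where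
  "lin E c =
     (case oper (ev E c) of
        LL i \<Rightarrow>
          (case response E c of
             None \<Rightarrow> None
           | Some (x, _) \<Rightarrow>
               if x \<in> {ret_L5, ret_L11} then step_point E c (\<lambda>l _. is_L3 l)
               else step_point E c (\<lambda>l _. is_L7 l))
      | SC i u \<Rightarrow>
          if \<exists>r. response E c = Some (ret_S1, r) then Some c
          else step_point E c (\<lambda>l y. is_S3 l \<and> y = Bool_resp True \<or> is_S4 l)
      | CL i \<Rightarrow> Some c
      | Read i \<Rightarrow> step_point E c (\<lambda>l _. is_R1 l)
      | VL i \<Rightarrow>
          if \<exists>r. response E c = Some (ret_V1, r) then Some c
          else step_point E c (\<lambda>l _. is_V2 l))"

text \<open>The calls \<open>f 0, f 1, ...\<close> with responses \<open>r 0, r 1, ...\<close> (there are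
  \<open>N\<close> of them) form a linearization of \<open>E\<close>. The responses of pending calls
  are constrained by the sequential specification only.\<close>

definition linearization ::
  "(nat \<Rightarrow> 'u) \<Rightarrow> 'u exec \<Rightarrow> enat \<Rightarrow> (nat \<Rightarrow> nat) \<Rightarrow> (nat \<Rightarrow> 'u resp) \<Rightarrow> bool" where
  "linearization u E N f r \<longleftrightarrow>
     inj_on f {j. enat j < N} \<and>
     f ` {j. enat j < N} \<subseteq> calls E \<and>
     {c \<in> calls E. response E c \<noteq> None} \<subseteq> f ` {j. enat j < N} \<and>
     (\<forall>j x v. enat j < N \<and> response E (f j) = Some (x, v) \<longrightarrow> r j = v) \<and>
     (\<forall>i j t. enat i < N \<and> enat j < N \<and> response_point E (f i) = Some t \<and> t < f j \<longrightarrow> i < j) \<and>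
     consistent_with_spec u N (\<lambda>j. (proc (ev E (f j)), oper (ev E (f j)), r j))"

text \<open>\<open>f 0, f 1, ...\<close> are the calls with defined linearization point, in the order of
  these points.\<close>

definition ordered_by_lin :: "'u exec \<Rightarrow> enat \<Rightarrow> (nat \<Rightarrow> nat) \<Rightarrow> bool" where
  "ordered_by_lin E N f \<longleftrightarrow>
     bij_betw f {j. enat j < N} {c \<in> calls E. lin E c \<noteq> None} \<and>
     (\<forall>i j. i < j \<and> enat j < N \<longrightarrow> the (lin E (f i)) < the (lin E (f j)))"

end

theory Submission
  imports Defs "HOL-Library.Infinite_Set"
begin

text \<open>Give every process and object a ghost bit that is set by L3 (provisionally, as L3 may turn out
  not to be the linearization point) and by an L7 that leads to L8 or L9, cleared for all processes by
  a successful CAS of SC, and cleared for one process by the invocation of CL. While a process has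
  \<open>d[i] = (v, t)\<close>, its bit determines whether a CAS of SC would succeed: if the bit is set, then
  \<open>L[i]\<close> is \<open>(v, t)\<close> or \<open>(v, 0)\<close>; otherwise the tag of \<open>L[i]\<close> is neither
  \<open>t\<close> nor \<open>0\<close>.

  Two facts keep this true. First, once \<open>R[t]\<close> has been incremented and \<open>L[i] = (v, t)\<close> has
  been read again, no SC can install \<open>t\<close> in \<open>L[i]\<close>: an SC that sampled \<open>t\<close> earlier is linked
  to a different tag, hence its bit has been cleared. Second, when K10 resets the tag, \<open>C[i]\<close>
  was \<open>0\<close> at K9 and no SC succeeded since then, so all links were made in the meantime and their bits
  are still set. The bound on the number of outstanding LL operations prevents overflows of \<open>R\<close>,
  because each of them accounts for at most one increment.

  The bits of the sequential specification then agree with the ghost bits, except for a process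
  inside an LL that has not yet been linearized: an LL whose L3 does not count has its bit set again
  by L7, and one that returns in L11 was overtaken by an SC that clears both bits.\<close>

section \<open>Ghost bits and the local invariant\<close>

fun sets_bit :: "'u action \<Rightarrow> bool" where
  "sets_bit (Step L3 y) = True"
| "sets_bit (Step (L7 v t) (Pair_resp (v', t'))) = ((v, t) = (v', t') \<or> t' = 0)"
| "sets_bit _ = False"

text \<open>A failed S3 is always followed by S4, so the outcome of an SC is decided by a successful
  S3 or by S4. This is the step at which \<open>lin\<close> places the SC.\<close>

fun cas_step :: "'u pc \<Rightarrow> 'u mem_resp \<Rightarrow> bool" where
  "cas_step (S3 g) y \<longleftrightarrow> y = Bool_resp True"
| "cas_step (S4 g) y \<longleftrightarrow> True"
| "cas_step _ _ \<longleftrightarrow> False"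

fun succeeds :: "'u action \<Rightarrow> bool" where
  "succeeds Invoke = False"
| "succeeds (Step c y) = (cas_step c y \<and> y = Bool_resp True)"

definition update_bits :: "'u event \<Rightarrow> (nat \<Rightarrow> nat \<Rightarrow> bool) \<Rightarrow> nat \<Rightarrow> nat \<Rightarrow> bool" where
  "update_bits e B = (\<lambda>q j.
     if j \<noteq> obj (oper e) then B q j
     else if succeeds (act e) then False
     else if q \<noteq> proc e then B q j
     else if sets_bit (act e) then True
     else if act e = Invoke \<and> (\<exists>i. oper e = CL i) then False
     else B q j)"

text \<open>Restricting the status to one object makes it possible to state invariants for each pair
  of a process and an object separately.\<close>

definition site :: "'u config \<Rightarrow> nat \<Rightarrow> nat \<Rightarrow> ('u op \<times> 'u pc) option" where
  "site S p i =
     (case status S p of None \<Rightarrow> None | Some (a, c) \<Rightarrow> if obj a = i then Some (a, c) else None)"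

text \<open>A set bit tolerates the reset of the tag by K10. A clear bit rules out success of both
  S3 and S4 through the tag alone, so it is harmless if the same value is stored again.\<close>

definition linked_ok :: "'u tagged \<Rightarrow> bool \<Rightarrow> 'u \<Rightarrow> nat \<Rightarrow> bool" where
  "linked_ok l b v t \<longleftrightarrow> (if b then l = (v, t) \<or> l = (v, 0) else snd l \<noteq> t \<and> snd l \<noteq> 0)"

definition rest_ok :: "'u tagged \<Rightarrow> bool \<Rightarrow> 'u tagged option \<Rightarrow> bool" where
  "rest_ok l b x \<longleftrightarrow> (case x of None \<Rightarrow> \<not> b | Some (v, t) \<Rightarrow> linked_ok l b v t)"

text \<open>A direct CL clears the bit on invocation. In SC, in VL and at L10 the preceding CAS or
  read has cleared the bit or found content that is incompatible with a set bit. At L1 the bit may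
  be stale, since L3 will set it anyway.\<close>

fun caller_ok :: "'u op \<Rightarrow> bool \<Rightarrow> 'u caller \<Rightarrow> bool" where
  "caller_ok a b Direct \<longleftrightarrow> (\<exists>i. a = CL i) \<and> \<not> b"
| "caller_ok a b From_L1 \<longleftrightarrow> (\<exists>i. a = LL i)"
| "caller_ok a b (From_L10 v) \<longleftrightarrow> (\<exists>i. a = LL i) \<and> \<not> b"
| "caller_ok a b (From_S5 r) \<longleftrightarrow> (\<exists>i u. a = SC i u) \<and> \<not> b"
| "caller_ok a b From_V3 \<longleftrightarrow> (\<exists>i. a = VL i) \<and> \<not> b"

text \<open>The arguments are the content of \<open>L[i]\<close>, the ghost bit, the entry of the
  dictionary and the site. In L6 and L7 a clear bit says nothing about the content, as the pair is
  not yet confirmed. In S4 a bit that is still set means that only the tag was reset, so S4 would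
  succeed. L9 is already linked to the untagged pair.\<close>

fun cell_ok :: "'u tagged \<Rightarrow> bool \<Rightarrow> 'u tagged option \<Rightarrow> ('u op \<times> 'u pc) option \<Rightarrow> bool" where
  "cell_ok l b x None \<longleftrightarrow> rest_ok l b x"
| "cell_ok l b x (Some (a, L2)) \<longleftrightarrow> (\<exists>i. a = LL i) \<and> x = None"
| "cell_ok l b x (Some (a, L3)) \<longleftrightarrow> (\<exists>i. a = LL i) \<and> x = None"
| "cell_ok l b x (Some (a, L6 v t)) \<longleftrightarrow>
     (\<exists>i. a = LL i) \<and> x = Some (v, t) \<and> t \<noteq> 0 \<and> (b \<longrightarrow> l = (v, t) \<or> l = (v, 0))"
| "cell_ok l b x (Some (a, L7 v t)) \<longleftrightarrow>
     (\<exists>i. a = LL i) \<and> x = Some (v, t) \<and> t \<noteq> 0 \<and> (b \<longrightarrow> l = (v, t) \<or> l = (v, 0))"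
| "cell_ok l b x (Some (a, L9 v t v')) \<longleftrightarrow>
     (\<exists>i. a = LL i) \<and> x = Some (v, t) \<and> t \<noteq> 0 \<and> linked_ok l b v' 0"
| "cell_ok l b x (Some (a, S2)) \<longleftrightarrow> (\<exists>i u. a = SC i u) \<and> x \<noteq> None \<and> rest_ok l b x"
| "cell_ok l b x (Some (a, S3 g)) \<longleftrightarrow> (\<exists>i u. a = SC i u) \<and> x \<noteq> None \<and> rest_ok l b x \<and> g \<noteq> 0"
| "cell_ok l b x (Some (a, S4 g)) \<longleftrightarrow>
     (\<exists>i u. a = SC i u) \<and> x \<noteq> None \<and> rest_ok l b x \<and> g \<noteq> 0 \<and> (b \<longrightarrow> l = (fst (the x), 0))"
| "cell_ok l b x (Some (a, K2 f)) \<longleftrightarrow> caller_ok a b f \<and> (\<exists>v t. x = Some (v, t) \<and> t \<noteq> 0)"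
| "cell_ok l b x (Some (a, K4 f)) \<longleftrightarrow> caller_ok a b f \<and> x = None"
| "cell_ok l b x (Some (a, K5 f)) \<longleftrightarrow> caller_ok a b f \<and> x = None"
| "cell_ok l b x (Some (a, K7 f v t)) \<longleftrightarrow> caller_ok a b f \<and> x = None \<and> t \<noteq> 0"
| "cell_ok l b x (Some (a, K8 f v t)) \<longleftrightarrow> caller_ok a b f \<and> x = None \<and> t \<noteq> 0"
| "cell_ok l b x (Some (a, K9 f v t)) \<longleftrightarrow> caller_ok a b f \<and> x = None \<and> t \<noteq> 0"
| "cell_ok l b x (Some (a, K10 f v t)) \<longleftrightarrow> caller_ok a b f \<and> x = None \<and> t \<noteq> 0"
| "cell_ok l b x (Some (a, K11 f v t)) \<longleftrightarrow> caller_ok a b f \<and> x = None \<and> t \<noteq> 0"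
| "cell_ok l b x (Some (a, R1)) \<longleftrightarrow> (\<exists>i. a = Read i) \<and> rest_ok l b x"
| "cell_ok l b x (Some (a, V2)) \<longleftrightarrow> (\<exists>i. a = VL i) \<and> x \<noteq> None \<and> rest_ok l b x"

text \<open>The pair that a finished or linearized LL relies on. In L6 and L7 the entry of the dictionary is
  not yet confirmed, and in L9 it is about to be replaced.\<close>

fun link :: "'u tagged option \<Rightarrow> ('u op \<times> 'u pc) option \<Rightarrow> 'u tagged option" where
  "link x (Some (a, L6 v t)) = None"
| "link x (Some (a, L7 v t)) = None"
| "link x (Some (a, L9 v t v')) = Some (v', 0)"
| "link x (Some (a, K2 f)) = None"
| "link x _ = x"

text \<open>The tag that cannot be installed in the object by an SC (\<open>0\<close> if there is none). It is
  incremented in \<open>R\<close> and was read from the object thereafter.\<close>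

fun guard :: "'u tagged option \<Rightarrow> ('u op \<times> 'u pc) option \<Rightarrow> nat" where
  "guard x (Some (a, K9 f v t)) = t"
| "guard x (Some (a, K10 f v t)) = t"
| "guard x s = (case link x s of None \<Rightarrow> 0 | Some (v, t) \<Rightarrow> t)"

text \<open>The tag \<open>t\<close> for which the process currently accounts for an increment of \<open>R[t]\<close>
  through this object (\<open>0\<close> if there is none).\<close>

fun reserved :: "'u tagged option \<Rightarrow> ('u op \<times> 'u pc) option \<Rightarrow> nat" where
  "reserved x (Some (a, L6 v t)) = 0"
| "reserved x (Some (a, K8 f v t)) = t"
| "reserved x (Some (a, K9 f v t)) = t"
| "reserved x (Some (a, K10 f v t)) = t"
| "reserved x (Some (a, K11 f v t)) = t"
| "reserved x _ = (case x of None \<Rightarrow> 0 | Some (v, t) \<Rightarrow> t)"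

text \<open>Whether the process currently accounts for an increment of \<open>C[i]\<close>.\<close>

fun counted :: "'u tagged option \<Rightarrow> ('u op \<times> 'u pc) option \<Rightarrow> bool" where
  "counted x (Some (a, L3)) = True"
| "counted x (Some (a, K4 f)) = True"
| "counted x _ = (x \<noteq> None)"

text \<open>The tag that a pending SC has sampled. The value \<open>0\<close> is never sampled.\<close>

fun tries :: "('u op \<times> 'u pc) option \<Rightarrow> nat" where
  "tries (Some (a, S3 g)) = g"
| "tries (Some (a, S4 g)) = g"
| "tries _ = 0"

section \<open>Effect of one step or invocation on a single process and object\<close>

lemma cell_ok_step:
  assumes "step n k a c d M y d' M' e" "cell_ok (objL M i) (B p i) (d i) (Some (a, c))" "i = obj a"
  shows "cell_ok (objL M' i) (update_bits \<lparr>proc = p, oper = a, act = Step c y, outcome = z\<rparr> B p i) (d' i)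
    (status_of a e)"
  using assms
  by (cases rule: step.cases)
    (auto simp: update_bits_def call_CL_def cas_def rest_ok_def linked_ok_def
      split: if_splits option.splits elim!: caller_ok.elims)

lemma cell_ok_start:
  assumes "start a x = (x', e)" "rest_ok l (B p i) (x i)" "i = obj a"
  shows "cell_ok l (update_bits \<lparr>proc = p, oper = a, act = Invoke, outcome = z\<rparr> B p i) (x' i) (status_of a e)"
  using assms
  by (cases a) (auto simp: update_bits_def call_CL_def rest_ok_def linked_ok_def split: if_splits option.splits)

text \<open>After a successful SC of another process, a link with a clear bit requires the new tag
  to differ from \<open>0\<close> and from the linked tag, which is its guard. A site without a link
  does not restrict the content once the bit is clear.\<close>

lemma cell_ok_overwritten:
  assumes "cell_ok l b x s" "g \<noteq> 0" "guard x s \<noteq> g"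
  shows "cell_ok (u, g) False x s"
  using assms
  by (induction l b x s rule: cell_ok.induct)
    (auto simp: rest_ok_def linked_ok_def split: option.splits elim!: caller_ok.elims)

text \<open>A link with a set bit accepts the pair with tag \<open>0\<close>, a link with a clear
  bit does not. The last premise is what \<open>resets_ok\<close> supplies for K10.\<close>

lemma cell_ok_untagged:
  assumes "cell_ok (w, t) b x s" "t \<noteq> 0" "link x s \<noteq> None \<Longrightarrow> b"
  shows "cell_ok (w, 0) b x s"
  using assms
  by (induction "(w, t)" b x s rule: cell_ok.induct)
    (auto simp: rest_ok_def linked_ok_def split: option.splits if_splits)

text \<open>Only S3, S4 and K10 can write to \<open>L[i]\<close>, and a failing CAS writes back the
  old content. By the local invariant S3 and S4 succeed only while the bit is set.\<close>

lemma step_objL_cases: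
  assumes "step n k a c d M y d' M' e" "cell_ok (objL M i) b (d i) (Some (a, c))" "i = obj a"
  obtains (same) "objL M' = objL M" "\<not> succeeds (Step c y)"
  | (store) u where "b" "succeeds (Step c y)" "objL M' = (objL M)(i := (u, tries (Some (a, c))))"
      "tries (Some (a, c)) \<noteq> 0"
  | (untag) f w t where "c = K10 f w t" "objL M i = (w, t)" "t \<noteq> 0" "objL M' = (objL M)(i := (w, 0))"
      "\<not> succeeds (Step c y)"
  using assms
  by (cases rule: step.cases)
    (auto simp: cas_def rest_ok_def linked_ok_def fun_upd_idem split: if_splits option.splits)

lemma step_dict:
  assumes "step n k a c d M y d' M' e" "j \<noteq> obj a"
  shows "d' j = d j"
  using assms by (cases rule: step.cases) (auto simp: call_CL_def split: if_splits option.splits)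

lemma start_dict:
  assumes "start a d = (d', e)" "j \<noteq> obj a"
  shows "d' j = d j"
  using assms by (cases a) (auto simp: call_CL_def split: if_splits option.splits)

text \<open>Adding on both sides avoids truncated subtraction. The bounds exclude overflows, where
  \<open>fai\<close> and \<open>fad\<close> leave the outcome open. The exception for
  \<open>R1\<close> reflects that a Read may run without an outstanding LL.\<close>

lemma step_objC:
  assumes "step n k a c d M y d' M' e" "cell_ok (objL M i) b (d i) (Some (a, c))" "i = obj a"
    "\<not> counted (d i) (Some (a, c)) \<Longrightarrow> c \<noteq> R1 \<Longrightarrow> objC M i < n"
    "counted (d i) (Some (a, c)) \<Longrightarrow> 0 < objC M i \<and> objC M i \<le> n"
  shows "objC M' j + of_bool (j = i \<and> counted (d i) (Some (a, c))) =
    objC M j + of_bool (j = i \<and> counted (d' i) (status_of a e))"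
  using assms
  by (cases rule: step.cases)
    (auto simp: call_CL_def fai_def fad_def rest_ok_def split: if_splits option.splits elim!: caller_ok.elims)

lemma step_objR:
  assumes "step n k a c d M y d' M' e" "cell_ok (objL M i) b (d i) (Some (a, c))" "i = obj a"
    "\<And>g. reserved (d i) (Some (a, c)) = 0 \<Longrightarrow> c \<noteq> R1 \<Longrightarrow> g \<noteq> 0 \<Longrightarrow> objR M g < k"
    "\<And>g. g \<noteq> 0 \<Longrightarrow> reserved (d i) (Some (a, c)) = g \<Longrightarrow> 0 < objR M g \<and> objR M g \<le> k"
    "g \<noteq> 0"
  shows "objR M' g + of_bool (reserved (d i) (Some (a, c)) = g) =
    objR M g + of_bool (reserved (d' i) (status_of a e) = g)"
  using assms
  by (cases rule: step.cases)
    (auto simp: call_CL_def fai_def fad_def rest_ok_def split: if_splits option.splits elim!: caller_ok.elims)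

lemma start_counted:
  assumes "start a d = (d', e)" "i = obj a"
  shows "counted (d' i) (status_of a e) = counted (d i) None"
  using assms by (cases a) (auto simp: call_CL_def split: if_splits option.splits)

lemma start_reserved:
  assumes "start a d = (d', e)" "i = obj a"
  shows "reserved (d' i) (status_of a e) = reserved (d i) None"
  using assms by (cases a) (auto simp: call_CL_def split: if_splits option.splits)

text \<open>A guarded tag is thus counted in \<open>R\<close>, so S2 does not accept it while it is
  guarded.\<close>

lemma guard_eq_reserved:
  assumes "cell_ok l b x s" "guard x s \<noteq> 0"
  shows "reserved x s = guard x s"
  using assms
  by (induction l b x s rule: cell_ok.induct) (auto split: option.splits)

lemma card_Collect_update:
  assumes "finite {x. P x}" "\<And>y. y \<noteq> x \<Longrightarrow> P' y = P y"
  shows "card {x. P' x} + of_bool (P x) = card {x. P x} + of_bool (P' x)"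
proof -
  have 1: "card {y. Q y} = card {y. P y \<and> y \<noteq> x} + of_bool (Q x)"
    if "\<And>y. y \<noteq> x \<Longrightarrow> Q y = P y" for Q
  proof -
    have "{y. Q y} = (if Q x then insert x {y. P y \<and> y \<noteq> x} else {y. P y \<and> y \<noteq> x})"
      using that by (auto simp: set_eq_iff) metis+
    moreover have "finite {y. P y \<and> y \<noteq> x}"
      by (rule finite_subset[OF _ assms(1)]) auto
    ultimately show ?thesis by auto
  qed
  show ?thesis using 1[of P] 1[of P'] assms(2) by simp
qed

text \<open>A nonzero guard begins with the second read, in L7 or K8, and this read has just
  returned the guarded tag.\<close>

lemma guard_step:
  assumes "step n k a c d M y d' M' e" "cell_ok (objL M i) b (d i) (Some (a, c))" "i = obj a"
    "guard (d' i) (status_of a e) \<noteq> 0"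
  shows "guard (d' i) (status_of a e) = guard (d i) (Some (a, c)) \<or>
    guard (d' i) (status_of a e) = snd (objL M i)"
  using assms
  by (cases rule: step.cases)
    (auto simp: call_CL_def cas_def rest_ok_def split: if_splits option.splits elim!: caller_ok.elims)

lemma tries_step:
  assumes "step n k a c d M y d' M' e" "cell_ok (objL M i) b (d i) (Some (a, c))" "i = obj a"
    "tries (status_of a e) \<noteq> 0"
  shows "\<not> sets_bit (Step c y) \<and> guard (d' i) (status_of a e) = guard (d i) (Some (a, c)) \<and>
    (tries (status_of a e) = tries (Some (a, c)) \<or> objR M (tries (status_of a e)) = 0)"
  using assms
  by (cases rule: step.cases)
    (auto simp: call_CL_def cas_def rest_ok_def split: if_splits option.splits elim!: caller_ok.elims)

lemma K10_step:
  assumes "step n k a c d M y d' M' e" "cell_ok (objL M i) b (d i) (Some (a, c))" "i = obj a"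
    "status_of a e = Some (a', K10 f w t)"
  shows "objC M i = 0 \<and> M' = M \<and> d' = d \<and> d i = None \<and> tries (Some (a, c)) = 0"
  using assms
  by (cases rule: step.cases)
    (auto simp: call_CL_def cas_def rest_ok_def split: if_splits option.splits elim!: caller_ok.elims)

lemma link_step:
  assumes "step n k a c d M y d' M' e" "cell_ok (objL M i) b (d i) (Some (a, c))" "i = obj a"
    "link (d' i) (status_of a e) \<noteq> None"
  shows "link (d i) (Some (a, c)) \<noteq> None \<or> sets_bit (Step c y)"
  using assms
  by (cases rule: step.cases)
    (auto simp: call_CL_def cas_def rest_ok_def split: if_splits option.splits elim!: caller_ok.elims)

lemma ends_step:
  assumes "step n k a c d M y d' M' e" "cell_ok (objL M i) b (d i) (Some (a, c))" "i = obj a"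
    "e = Return x r" "(\<exists>u. a = SC i u) \<or> a = CL i \<or> a = VL i \<and> r = Bool False"
  shows "d' i = None"
  using assms
  by (cases rule: step.cases)
    (auto simp: call_CL_def cas_def rest_ok_def split: if_splits option.splits elim!: caller_ok.elims)

lemma R1_step:
  assumes "step n k a R1 d M y d' M' e"
  shows "d' = d \<and> status_of a e = None"
  using assms by (cases rule: step.cases) auto

lemma start_site:
  assumes "start a d = (d', e)" "i = obj a"
  shows "tries (status_of a e) = 0"
    and "\<And>a' f w t. status_of a e \<noteq> Some (a', K10 f w t)"
    and "guard (d' i) (status_of a e) \<noteq> 0 \<Longrightarrow> guard (d' i) (status_of a e) = guard (d i) None"
    and "link (d' i) (status_of a e) \<noteq> None \<Longrightarrow> link (d i) None \<noteq> None \<and> (\<nexists>i. a = CL i)"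
    and "e = Return x r \<Longrightarrow> (\<exists>u. a = SC i u) \<or> a = CL i \<or> a = VL i \<and> r = Bool False \<Longrightarrow> d' i = None"
    and "d' i \<noteq> None \<Longrightarrow> d i \<noteq> None"
    and "status_of a e = Some (a', c) \<Longrightarrow> c \<noteq> R1 \<Longrightarrow> d i \<noteq> None \<or> (\<exists>i. a = LL i)"
  using assms by (cases a; auto simp: call_CL_def split: if_splits option.splits)+

text \<open>With exact counters, reading \<open>C[i] = 0\<close> at K9 therefore shows that no
  process has a link at that moment.\<close>

lemma link_counted:
  assumes "cell_ok l b x s" "link x s \<noteq> None"
  shows "counted x s"
  using assms by (induction l b x s rule: cell_ok.induct) auto

text \<open>While its bit is set, an SC is linked to the current pair, possibly untagged since. A
  nonzero tag that another process starts to guard is then the guard of the SC itself and hence not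
  the tag that it sampled.\<close>

lemma tries_cell_ok:
  assumes "cell_ok l b x s" "tries s \<noteq> 0" b
  shows "snd l = 0 \<or> guard x s = snd l"
  using assms by (induction l b x s rule: cell_ok.induct)
    (auto simp: rest_ok_def linked_ok_def split: option.splits)

text \<open>Translates a transition into its effect on sites and dictionary entries, which is
  confined to the acting process and the object of its call.\<close>

lemma site_cases:
  assumes "transition n m k S e S'"
  obtains (invocation) p a d f where "e = \<lparr>proc = p, oper = a, act = Invoke, outcome = outcome_of f\<rparr>"
      "p \<in> {1..n}" "obj a \<in> {1..m}" "start a (dict S p) = (d, f)" "mem S' = mem S"
      "\<And>i. site S p i = None" "dict S' p (obj a) = d (obj a)" "site S' p (obj a) = status_of a f"
      "\<And>q j. (q, j) \<noteq> (p, obj a) \<Longrightarrow> site S' q j = site S q j \<and> dict S' q j = dict S q j"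
  | (shared_step) p a c y d M f where "e = \<lparr>proc = p, oper = a, act = Step c y, outcome = outcome_of f\<rparr>"
      "step n k a c (dict S p) (mem S) y d M f" "mem S' = M"
      "site S p (obj a) = Some (a, c)" "dict S' p (obj a) = d (obj a)" "site S' p (obj a) = status_of a f"
      "\<And>q j. (q, j) \<noteq> (p, obj a) \<Longrightarrow> site S' q j = site S q j \<and> dict S' q j = dict S q j"
  using assms
proof cases
  case (invocation p a d f)
  have "site S' p (obj a) = status_of a f"
    using invocation by (cases f) (auto simp: site_def)
  moreover have "site S' q j = site S q j" if "(q, j) \<noteq> (p, obj a)" for q j
    using invocation that by (cases f) (auto simp: site_def)
  moreover have "dict S' q j = dict S q j" if "(q, j) \<noteq> (p, obj a)" for q j
    using invocation that start_dict[OF invocation(6)] by auto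
  ultimately show ?thesis
    using invocation that(1)[of p a f d] by (auto simp: site_def)
next
  case (shared_step p a c y d M f)
  have "site S' p (obj a) = status_of a f"
    using shared_step by (cases f) (auto simp: site_def)
  moreover have "site S' q j = site S q j" if "(q, j) \<noteq> (p, obj a)" for q j
    using shared_step that by (cases f) (auto simp: site_def)
  moreover have "dict S' q j = dict S q j" if "(q, j) \<noteq> (p, obj a)" for q j
    using shared_step that step_dict[OF shared_step(4)] by auto
  ultimately show ?thesis
    using shared_step that(2)[of p a c y f d M] by (auto simp: site_def)
qed

section \<open>Invariants of configurations\<close>

definition cells_ok :: "(nat \<Rightarrow> nat \<Rightarrow> bool) \<Rightarrow> 'u config \<Rightarrow> bool" where
  "cells_ok B S \<longleftrightarrow> (\<forall>p i. cell_ok (objL (mem S) i) (B p i) (dict S p i) (site S p i))"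

text \<open>The case \<open>q = r\<close> matters: an SC has not sampled the tag that it is linked
  to. This is what excludes the sampled tag when another process acquires a guard.\<close>

definition tags_ok :: "(nat \<Rightarrow> nat \<Rightarrow> bool) \<Rightarrow> 'u config \<Rightarrow> bool" where
  "tags_ok B S \<longleftrightarrow>
     (\<forall>q r i. tries (site S r i) \<noteq> 0 \<and> B r i \<longrightarrow> guard (dict S q i) (site S q i) \<noteq> tries (site S r i))"

text \<open>The condition on \<open>L[i]\<close> says that K10 would succeed. Once an SC has
  overwritten the pair, links with clear bits may exist, but then the CAS of K10 fails.\<close>

definition resets_ok :: "(nat \<Rightarrow> nat \<Rightarrow> bool) \<Rightarrow> 'u config \<Rightarrow> bool" where
  "resets_ok B S \<longleftrightarrow>
     (\<forall>p q i a f w t. site S q i = Some (a, K10 f w t) \<and> objL (mem S) i = (w, t) \<and>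
        link (dict S p i) (site S p i) \<noteq> None \<longrightarrow> B p i)"

definition counters_ok :: "'u config \<Rightarrow> bool" where
  "counters_ok S \<longleftrightarrow>
     (\<forall>i. objC (mem S) i = card {p. counted (dict S p i) (site S p i)}) \<and>
     (\<forall>g. g \<noteq> 0 \<longrightarrow> objR (mem S) g = card {x. reserved (dict S (fst x) (snd x)) (site S (fst x) (snd x)) = g})"

text \<open>\<open>Q\<close> stands for the set of outstanding LL operations. Only a Read accesses
  shared memory without one, hence the exception for \<open>R1\<close>.\<close>

definition outstanding_ok :: "nat \<Rightarrow> nat \<Rightarrow> (nat \<times> nat) set \<Rightarrow> 'u config \<Rightarrow> bool" where
  "outstanding_ok n m Q S \<longleftrightarrow> Q \<subseteq> {1..n} \<times> {1..m} \<and>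
     (\<forall>p i. dict S p i \<noteq> None \<or> (\<exists>a c. site S p i = Some (a, c) \<and> c \<noteq> R1) \<longrightarrow> (p, i) \<in> Q)"

definition update_outstanding :: "'u event \<Rightarrow> (nat \<times> nat) set \<Rightarrow> (nat \<times> nat) set" where
  "update_outstanding e Q =
     (if act e = Invoke \<and> (\<exists>i. oper e = LL i) then insert (proc e, obj (oper e)) Q
      else if ends_LL (proc e) (obj (oper e)) e then Q - {(proc e, obj (oper e))}
      else Q)"

section \<open>Preservation of the invariants by transitions\<close>

lemma cells_ok_transition:
  assumes tr: "transition n m k S e S'" and c: "cells_ok B S" and t: "tags_ok B S" and r: "resets_ok B S"
  shows "cells_ok (update_bits e B) S'"
  using tr
proof (cases rule: site_cases)
  case (invocation p a d f)
  have "cell_ok (objL (mem S') j) (update_bits e B q j) (dict S' q j) (site S' q j)" for q j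
  proof (cases "(q, j) = (p, obj a)")
    case True
    have "rest_ok (objL (mem S) j) (B p j) (dict S p j)"
      using c invocation by (metis cells_ok_def cell_ok.simps(1))
    then show ?thesis
      using cell_ok_start[OF invocation(4), of "objL (mem S) j" B p j "outcome_of f"] invocation True
      by auto
  next
    case False
    then have "update_bits e B q j = B q j"
      using invocation by (auto simp: update_bits_def)
    with False show ?thesis using invocation c by (auto simp: cells_ok_def)
  qed
  then show ?thesis by (simp add: cells_ok_def)
next
  case (shared_step p a c0 y d M f)
  let ?i = "obj a"
  have self: "cell_ok (objL (mem S) ?i) (B p ?i) (dict S p ?i) (Some (a, c0))"
    using c shared_step by (metis cells_ok_def)
  have "cell_ok (objL M j) (update_bits e B q j) (dict S' q j) (site S' q j)" for q j
  proof (cases "(q, j) = (p, obj a)")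
    case True
    moreover have "cell_ok (objL M ?i) (update_bits e B p ?i) (d ?i) (status_of a f)"
      unfolding shared_step(1) by (rule cell_ok_step[where B = B and p = p, OF shared_step(2) self refl])
    ultimately show ?thesis using shared_step(5,6) by simp
  next
    case other: False
    have old: "cell_ok (objL (mem S) j) (B q j) (dict S' q j) (site S' q j)"
      using c other shared_step by (auto simp: cells_ok_def)
    from shared_step(2) self refl show ?thesis
    proof (cases rule: step_objL_cases)
      case same
      then have "update_bits e B q j = B q j"
        using other shared_step by (auto simp: update_bits_def)
      with old same show ?thesis by simp
    next
      case (store u)
      show ?thesis
      proof (cases "j = ?i")
        case True
        then have "update_bits e B q j = False"
          using store shared_step by (auto simp: update_bits_def)
        \<comment> \<open>The storing process has its bit set, so its sampled tag is not guarded by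
          anyone.\<close>
        moreover have "guard (dict S' q j) (site S' q j) \<noteq> tries (Some (a, c0))"
          using t store other shared_step True by (metis tags_ok_def)
        ultimately show ?thesis
          using cell_ok_overwritten[OF old] store True by simp
      next
        case False
        then show ?thesis using old store shared_step by (auto simp: update_bits_def)
      qed
    next
      case (untag g w t)
      have "update_bits e B q j = B q j"
        using other shared_step untag by (auto simp: update_bits_def)
      moreover have "cell_ok (w, 0) (B q j) (dict S' q j) (site S' q j)" if "j = ?i"
      proof (rule cell_ok_untagged[OF _ untag(3)])
        show "cell_ok (w, t) (B q j) (dict S' q j) (site S' q j)"
          using old untag that by simp
        \<comment> \<open>The acting process is at K10 and its CAS succeeds, which is the situation
          described by \<open>resets_ok\<close>.\<close>
        show "B q j" if "link (dict S' q j) (site S' q j) \<noteq> None"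
          using r shared_step untag other \<open>j = ?i\<close> that unfolding resets_ok_def by metis
      qed
      ultimately show ?thesis using old untag by auto
    qed
  qed
  then show ?thesis using shared_step by (simp add: cells_ok_def)
qed

lemma reserved_subset_outstanding:
  assumes "cells_ok B S" "outstanding_ok n m Q S" "g \<noteq> 0"
  shows "{x. reserved (dict S (fst x) (snd x)) (site S (fst x) (snd x)) = g} \<subseteq> Q"
proof (clarify, simp)
  fix p i assume *: "g = reserved (dict S p i) (site S p i)"
  have "cell_ok (objL (mem S) i) (B p i) (dict S p i) (site S p i)"
    using assms by (simp add: cells_ok_def)
  then have "dict S p i \<noteq> None \<or> (\<exists>a c. site S p i = Some (a, c) \<and> c \<noteq> R1)"
    using * assms(3) by (cases "site S p i"; cases "dict S p i") auto
  then show "(p, i) \<in> Q" using assms(2) by (auto simp: outstanding_ok_def)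
qed

lemma counted_subset_processes:
  assumes "outstanding_ok n m Q S"
  shows "{p. counted (dict S p i) (site S p i)} \<subseteq> {1..n}"
proof clarify
  fix p assume *: "counted (dict S p i) (site S p i)"
  then have "dict S p i \<noteq> None \<or> (\<exists>a c. site S p i = Some (a, c) \<and> c \<noteq> R1)"
    by (cases "(dict S p i, site S p i)" rule: counted.cases) auto
  then have "(p, i) \<in> Q" using assms(1) by (auto simp: outstanding_ok_def)
  then show "p \<in> {1..n}" using assms(1) by (auto simp: outstanding_ok_def)
qed

text \<open>A violation could arise in two ways. If \<open>r\<close> has just sampled the tag,
  \<open>R\<close> was \<open>0\<close>, but a guard is counted in \<open>R\<close>. If
  \<open>q\<close> has just acquired the guard, it is the current tag of the object, which by the
  set bit of \<open>r\<close> is \<open>0\<close> or the guard of \<open>r\<close> itself.\<close>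

lemma tags_ok_transition:
  assumes tr: "transition n m k S e S'" and c: "cells_ok B S" and t: "tags_ok B S"
    and co: "counters_ok S" and Q: "outstanding_ok n m Q S"
  shows "tags_ok (update_bits e B) S'"
  unfolding tags_ok_def
proof (intro allI impI, elim conjE)
  fix q r i
  assume g: "tries (site S' r i) \<noteq> 0" and b: "update_bits e B r i"
  have cell: "cell_ok (objL (mem S) j) (B p j) (dict S p j) (site S p j)" for p j
    using c by (simp add: cells_ok_def)
  show "guard (dict S' q i) (site S' q i) \<noteq> tries (site S' r i)" (is "?G \<noteq> ?g")
  proof
    assume eq: "?G = ?g"
    show False using tr
    proof (cases rule: site_cases)
      case (invocation p a d f)
      note st = start_site[OF invocation(4) refl]
      have r: "(r, i) \<noteq> (p, obj a)" using g st(1) invocation by auto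
      then have "B r i" using b invocation by (auto simp: update_bits_def split: if_splits)
      moreover have "?G = guard (dict S q i) (site S q i)"
        using st(3) invocation g eq by (cases "(q, i) = (p, obj a)") auto
      ultimately show ?thesis using t g eq r invocation by (metis tags_ok_def)
    next
      case (shared_step p a c0 y d M f)
      let ?i = "obj a"
      have self: "cell_ok (objL (mem S) ?i) (B p ?i) (dict S p ?i) (Some (a, c0))"
        using cell[of ?i p] shared_step by simp
      have G: "?G = guard (dict S q i) (site S q i) \<or> (q, i) = (p, ?i) \<and> ?G = snd (objL (mem S) i)"
        using guard_step[OF shared_step(2) self] shared_step g eq by (cases "(q, i) = (p, ?i)") auto
      show ?thesis
      proof (cases "(r, i) = (p, ?i)")
        case True
        note T = tries_step[OF shared_step(2) self refl]
        have "B r i" using b T True shared_step g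
          by (auto simp: update_bits_def split: if_splits)
        moreover have G: "?G = guard (dict S q i) (site S q i)"
          using T True shared_step g by (cases "q = p") auto
        moreover have "?g \<noteq> tries (site S r i) \<Longrightarrow> objR (mem S) ?g = 0"
          using T True shared_step g by auto
        moreover have "objR (mem S) ?g \<noteq> 0"
        proof -
          have "(q, i) \<in> {x. reserved (dict S (fst x) (snd x)) (site S (fst x) (snd x)) = ?g}"
            using guard_eq_reserved[OF cell, of q i] G eq g by auto
          moreover have "finite Q"
            using Q by (auto simp: outstanding_ok_def intro: finite_subset)
          then have "finite {x. reserved (dict S (fst x) (snd x)) (site S (fst x) (snd x)) = ?g}"
            using reserved_subset_outstanding[OF c Q g] finite_subset by blast
          ultimately have "card {x. reserved (dict S (fst x) (snd x)) (site S (fst x) (snd x)) = ?g} \<noteq> 0"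
            by auto
          then show ?thesis using co g by (simp add: counters_ok_def)
        qed
        ultimately show ?thesis using t eq g by (metis tags_ok_def)
      next
        case False
        have B: "B r i" using b False shared_step by (auto simp: update_bits_def split: if_splits)
        have "?g = tries (site S r i)" using False shared_step by simp
        moreover from this have "?G \<noteq> guard (dict S p' i) (site S p' i)" for p'
          using t eq g B unfolding tags_ok_def by metis
        moreover from this have "snd (objL (mem S) i) = ?G" using G by auto
        ultimately show ?thesis
          using tries_cell_ok[OF cell[of i r]] B g eq by metis
      qed
    qed
  qed
qed

text \<open>When K9 reads \<open>C[i] = 0\<close>, there are no links. Later links arise together
  with their bits, and an SC that clears bits installs a tag other than the one guarded by K10, so
  that the CAS of K10 would fail.\<close>

lemma resets_ok_transition:
  assumes tr: "transition n m k S e S'" and c: "cells_ok B S" and t: "tags_ok B S" and r: "resets_ok B S"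
    and co: "counters_ok S" and Q: "outstanding_ok n m Q S"
  shows "resets_ok (update_bits e B) S'"
  unfolding resets_ok_def
proof (intro allI impI, elim conjE)
  fix p' q i a' g w s
  assume K: "site S' q i = Some (a', K10 g w s)" and L: "objL (mem S') i = (w, s)"
    and l: "link (dict S' p' i) (site S' p' i) \<noteq> None"
  have cell: "cell_ok (objL (mem S) j) (B p j) (dict S p j) (site S p j)" for p j
    using c by (simp add: cells_ok_def)
  show "update_bits e B p' i" using tr
  proof (cases rule: site_cases)
    case (invocation p a d f)
    note st = start_site[OF invocation(4) refl]
    have q: "(q, i) \<noteq> (p, obj a)" using K st(2) invocation by auto
    then have "link (dict S p' i) (site S p' i) \<noteq> None"
      using l invocation st(4) by (cases "(p', i) = (p, obj a)") auto
    then have "B p' i" using r K L invocation q unfolding resets_ok_def by metis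
    moreover have "update_bits e B p' i = B p' i"
    proof (cases "(p', i) = (p, obj a)")
      case True
      then have "link (d (obj a)) (status_of a f) \<noteq> None" using l invocation(7,8) by simp
      then have "\<nexists>i. a = CL i" using st(4) by auto
      then show ?thesis unfolding update_bits_def invocation(1) by auto
    next
      case False
      then show ?thesis unfolding update_bits_def invocation(1) by auto
    qed
    ultimately show ?thesis by simp
  next
    case (shared_step p a c0 y d M f)
    let ?i = "obj a"
    have self: "cell_ok (objL (mem S) ?i) (B p ?i) (dict S p ?i) (Some (a, c0))"
      using cell[of ?i p] shared_step by simp
    have "cell_ok (objL (mem S') i) (update_bits e B q i) (dict S' q i) (site S' q i)"
      using cells_ok_transition[OF tr c t r] by (simp add: cells_ok_def)
    then have "s \<noteq> 0" using K by simp
    show ?thesis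
    proof (cases "i = ?i")
      case False
      from step_objL_cases[OF shared_step(2) self refl]
      have "objL M i = objL (mem S) i"
        by cases (simp_all add: False)
      moreover have "site S' q i = site S q i" "site S' p' i = site S p' i" "dict S' p' i = dict S p' i"
        using False shared_step(7) by auto
      ultimately have "B p' i"
        using K L l r[unfolded resets_ok_def, rule_format, of q i a' g w s p']
        unfolding shared_step(3) by simp
      then show ?thesis using False shared_step(1) by (simp add: update_bits_def)
    next
      case True
      note K10 = K10_step[OF shared_step(2) self refl]
      from shared_step(2) self refl show ?thesis
      proof (cases rule: step_objL_cases)
        case same
        show ?thesis
        proof (cases "q = p")
          case q: True
          then have 0: "objC (mem S) i = 0" "dict S p i = None" "d = dict S p"
            using K10 K True shared_step by auto
          have "p' \<noteq> p" using l 0 K q True shared_step by auto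
          then have "link (dict S p' i) (site S p' i) \<noteq> None" using l True shared_step by auto
          then have "p' \<in> {p. counted (dict S p i) (site S p i)}"
            using link_counted[OF cell] by auto
          moreover have "finite {p. counted (dict S p i) (site S p i)}"
            using counted_subset_processes[OF Q] finite_subset by blast
          ultimately have "card {p. counted (dict S p i) (site S p i)} \<noteq> 0" by auto
          then have "objC (mem S) i \<noteq> 0" using co by (simp add: counters_ok_def)
          then show ?thesis using 0 by simp
        next
          case q: False
          then have 1: "link (dict S p' i) (site S p' i) \<noteq> None \<Longrightarrow> B p' i"
            using r K L same shared_step unfolding resets_ok_def
            by (metis prod.inject)
          show ?thesis
          proof (cases "p' = p")
            case p': True
            then show ?thesis
              using link_step[OF shared_step(2) self refl] 1 l True same shared_step
              by (auto simp: update_bits_def)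
          next
            case False
            then show ?thesis using 1 l same shared_step by (auto simp: update_bits_def)
          qed
        qed
      next
        case (store u)
        have "q \<noteq> p" using K10 K store True shared_step by auto
        then have "guard (dict S q i) (site S q i) = s" using K shared_step by auto
        moreover have "s = tries (site S p i)" using L store True shared_step by auto
        ultimately show ?thesis using t store True \<open>s \<noteq> 0\<close> shared_step unfolding tags_ok_def by metis
      next
        case (untag f w t)
        then show ?thesis using L \<open>s \<noteq> 0\<close> shared_step True by auto
      qed
    qed
  qed
qed

text \<open>Each process accounts for at most one unit of \<open>C[i]\<close>, and each outstanding
  LL for at most one unit of \<open>R[g]\<close>. If the acting process does not account for a unit
  yet, the bounds \<open>n\<close> and \<open>k\<close> are strict, so the increment does not
  overflow.\<close>

lemma counters_ok_transition:
  assumes tr: "transition n m k S e S'" and c: "cells_ok B S"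
    and co: "counters_ok S" and Q: "outstanding_ok n m Q S" and k: "card Q \<le> k"
  shows "counters_ok S'"
proof -
  let ?C = "\<lambda>S i p. counted (dict S p i) (site S p i)"
  let ?R = "\<lambda>S g x. reserved (dict S (fst x) (snd x)) (site S (fst x) (snd x)) = g"
  have finC: "finite {p. ?C S i p}" for i
    using counted_subset_processes[OF Q] finite_subset by blast
  have finQ: "finite Q"
    using Q by (auto simp: outstanding_ok_def intro: finite_subset)
  have finR: "finite {x. ?R S g x}" if "g \<noteq> 0" for g
    using reserved_subset_outstanding[OF c Q that] finQ finite_subset by blast
  have C: "objC (mem S) i = card {p. ?C S i p}" for i
    using co by (simp add: counters_ok_def)
  have R: "objR (mem S) g = card {x. ?R S g x}" if "g \<noteq> 0" for g
    using co that by (simp add: counters_ok_def)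
  show ?thesis using tr
  proof (cases rule: site_cases)
    case (invocation p a d f)
    have "?C S' i q = ?C S i q" for i q
      using start_counted[OF invocation(4) refl] invocation by (cases "(q, i) = (p, obj a)") auto
    moreover have "?R S' g x = ?R S g x" for g x
      using start_reserved[OF invocation(4) refl] invocation by (cases "x = (p, obj a)"; cases x) auto
    ultimately show ?thesis using co invocation by (simp add: counters_ok_def)
  next
    case (shared_step p a c0 y d M f)
    let ?i = "obj a"
    have self: "cell_ok (objL (mem S) ?i) (B p ?i) (dict S p ?i) (Some (a, c0))"
      using c shared_step by (metis cells_ok_def)
    have inQ: "(p, ?i) \<in> Q" if "c0 \<noteq> R1"
      using that Q shared_step by (auto simp: outstanding_ok_def)
    have "objC M j = card {q. ?C S' j q}" for j
    proof -
      have pn: "p \<in> {1..n}" if "c0 \<noteq> R1"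
        using inQ that Q by (auto simp: outstanding_ok_def)
      have "objC M j + of_bool (j = ?i \<and> ?C S ?i p) = objC (mem S) j + of_bool (j = ?i \<and> ?C S' ?i p)"
      proof -
        have 1: "objC (mem S) ?i < n" if "\<not> ?C S ?i p" "c0 \<noteq> R1"
        proof -
          have "{q. ?C S ?i q} \<subseteq> {1..n} - {p}"
            using that(1) counted_subset_processes[OF Q] by auto
          then have "card {q. ?C S ?i q} \<le> card ({1..n} - {p})"
            by (intro card_mono) auto
          also have "\<dots> < n" using pn[OF that(2)] by auto
          finally show ?thesis using C by simp
        qed
        have 2: "0 < objC (mem S) ?i \<and> objC (mem S) ?i \<le> n" if "?C S ?i p"
          using that C[of ?i] finC card_mono[OF _ counted_subset_processes[OF Q], of ?i]
          by (auto simp: card_gt_0_iff)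
        show ?thesis
          using step_objC[OF shared_step(2) self refl] 1 2 shared_step by auto
      qed
      moreover have "card {q. ?C S' j q} + of_bool (?C S j p) = card {q. ?C S j q} + of_bool (?C S' j p)"
        using shared_step finC by (intro card_Collect_update) auto
      moreover have "?C S' j p = ?C S j p" if "j \<noteq> ?i"
        using that shared_step by auto
      ultimately show ?thesis using C[of j] by (cases "j = ?i") auto
    qed
    moreover have "objR M g = card {x. ?R S' g x}" if g: "g \<noteq> 0" for g
    proof -
      have "objR M g + of_bool (?R S g (p, ?i)) = objR (mem S) g + of_bool (?R S' g (p, ?i))"
      proof -
        have 1: "objR (mem S) g < k"
          if "reserved (dict S p ?i) (Some (a, c0)) = 0" "c0 \<noteq> R1" "g \<noteq> 0" for g
        proof -
          have "{x. ?R S g x} \<subseteq> Q - {(p, ?i)}"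
            using that reserved_subset_outstanding[OF c Q, of g] shared_step by auto
          then have "card {x. ?R S g x} \<le> card (Q - {(p, ?i)})"
            using finQ by (intro card_mono) auto
          also have "\<dots> < card Q" using inQ[OF that(2)] finQ by (meson card_Diff1_less)
          finally show ?thesis using R[OF that(3)] k by simp
        qed
        have 2: "0 < objR (mem S) g \<and> objR (mem S) g \<le> k"
          if "reserved (dict S p ?i) (Some (a, c0)) = g" "g \<noteq> 0" for g
        proof -
          have "(p, ?i) \<in> {x. ?R S g x}" using that shared_step by auto
          then have "0 < card {x. ?R S g x}" using finR[OF that(2)] by (auto simp: card_gt_0_iff)
          moreover have "card {x. ?R S g x} \<le> card Q"
            using reserved_subset_outstanding[OF c Q that(2)] finQ by (intro card_mono) auto
          ultimately show ?thesis using R[OF that(2)] k by simp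
        qed
        show ?thesis
          using step_objR[OF shared_step(2) self refl 1 2 g] shared_step by auto
      qed
      moreover have "card {x. ?R S' g x} + of_bool (?R S g (p, ?i)) = card {x. ?R S g x} + of_bool (?R S' g (p, ?i))"
      proof (rule card_Collect_update[OF finR[OF g]])
        show "?R S' g x = ?R S g x" if "x \<noteq> (p, ?i)" for x
          using that shared_step by (cases x) auto
      qed
      ultimately show ?thesis using R[OF g] by linarith
    qed
    ultimately show ?thesis using shared_step by (simp add: counters_ok_def)
  qed
qed

lemma ends_LL_outcome_of:
  "ends_LL p j \<lparr>proc = p, oper = a, act = z, outcome = outcome_of f\<rparr> \<longleftrightarrow>
     (\<exists>x r. f = Return x r \<and> ((\<exists>u. a = SC j u) \<or> a = CL j \<or> a = VL j \<and> r = Bool False))"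
  by (cases f) (auto simp: ends_LL_def)

text \<open>An LL enters \<open>Q\<close> when invoked, and SC, CL and VL reach their first memory
  step only with an entry in the dictionary. A call that removes the pair from \<open>Q\<close>
  leaves the entry empty and the process idle.\<close>

lemma outstanding_ok_transition:
  assumes tr: "transition n m k S e S'" and c: "cells_ok B S" and Q: "outstanding_ok n m Q S"
  shows "outstanding_ok n m (update_outstanding e Q) S'"
proof -
  have old: "(p, i) \<in> Q" if "dict S p i \<noteq> None \<or> (\<exists>a c. site S p i = Some (a, c) \<and> c \<noteq> R1)" for p i
    using that Q unfolding outstanding_ok_def by blast
  have "(q, j) \<in> update_outstanding e Q"
    if new: "dict S' q j \<noteq> None \<or> (\<exists>a c. site S' q j = Some (a, c) \<and> c \<noteq> R1)" for q j
    using tr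
  proof (cases rule: site_cases)
    case (invocation p a d f)
    note st = start_site[OF invocation(4) refl]
    show ?thesis
    proof (cases "(q, j) = (p, obj a)")
      case True
      then have "dict S p j \<noteq> None \<or> (\<exists>i. a = LL i)"
        using new invocation st(6,7) by auto
      moreover have "\<not> ends_LL p j e"
      proof
        assume "ends_LL p j e"
        then obtain x r where f: "f = Return x r" and
            r: "(\<exists>u. a = SC j u) \<or> a = CL j \<or> a = VL j \<and> r = Bool False"
          unfolding invocation(1) ends_LL_outcome_of by blast
        have "j = obj a" using True by simp
        have "d (obj a) = None" using st(5)[OF f] r[unfolded \<open>j = obj a\<close>] by blast
        moreover have "site S' p (obj a) = None" unfolding invocation(8) f by simp
        ultimately show False using new True invocation(7) by auto
      qed
      ultimately show ?thesis
        using True old[of p j] unfolding update_outstanding_def invocation(1) by auto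
    next
      case False
      then show ?thesis
        using new old[of q j] invocation(9) unfolding update_outstanding_def invocation(1) by auto
    qed
  next
    case (shared_step p a c0 y d M f)
    let ?i = "obj a"
    have self: "cell_ok (objL (mem S) ?i) (B p ?i) (dict S p ?i) (Some (a, c0))"
      using c shared_step by (metis cells_ok_def)
    show ?thesis
    proof (cases "(q, j) = (p, obj a)")
      case True
      have "(p, j) \<in> Q"
      proof (cases "c0 = R1")
        case R1: True
        have "d = dict S p" "status_of a f = None"
          using R1_step[OF shared_step(2)[unfolded R1]] by simp_all
        then have "dict S p j \<noteq> None" using new True shared_step(5,6) by auto
        then show ?thesis using old by blast
      next
        case False
        then show ?thesis using old[of p j] shared_step(4) True by auto
      qed
      moreover have "\<not> ends_LL p j e"
      proof
        assume "ends_LL p j e"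
        then obtain x r where f: "f = Return x r" and
            r: "(\<exists>u. a = SC j u) \<or> a = CL j \<or> a = VL j \<and> r = Bool False"
          unfolding shared_step(1) ends_LL_outcome_of by blast
        have "j = obj a" using True by simp
        have "d (obj a) = None" using ends_step[OF shared_step(2) self refl f] r[unfolded \<open>j = obj a\<close>] by blast
        moreover have "site S' p (obj a) = None" unfolding shared_step(6) f by simp
        ultimately show False using new True shared_step(5) by auto
      qed
      ultimately show ?thesis using True unfolding update_outstanding_def shared_step(1) by auto
    next
      case False
      then show ?thesis
        using new old[of q j] shared_step(7) unfolding update_outstanding_def shared_step(1) by auto
    qed
  qed
  moreover have "update_outstanding e Q \<subseteq> {1..n} \<times> {1..m}"
    using tr Q by (cases rule: site_cases) (auto simp: update_outstanding_def outstanding_ok_def)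
  ultimately show ?thesis by (simp add: outstanding_ok_def)
qed

section \<open>History of a call\<close>

abbreviation reads_L3 :: "'u pc \<Rightarrow> 'u mem_resp \<Rightarrow> bool" where
  "reads_L3 \<equiv> \<lambda>l _. is_L3 l"

abbreviation reads_L7 :: "'u pc \<Rightarrow> 'u mem_resp \<Rightarrow> bool" where
  "reads_L7 \<equiv> \<lambda>l _. is_L7 l"

abbreviation confirms_L7 :: "'u pc \<Rightarrow> 'u mem_resp \<Rightarrow> bool" where
  "confirms_L7 \<equiv> \<lambda>l y. is_L7 l \<and> sets_bit (Step l y)"

abbreviation reads_R1 :: "'u pc \<Rightarrow> 'u mem_resp \<Rightarrow> bool" where
  "reads_R1 \<equiv> \<lambda>l _. is_R1 l"

abbreviation reads_V2 :: "'u pc \<Rightarrow> 'u mem_resp \<Rightarrow> bool" where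
  "reads_V2 \<equiv> \<lambda>l _. is_V2 l"

text \<open>In the following predicates, \<open>X P\<close> is the set of the points of the call so far at which it
  made a step satisfying \<open>P\<close>, and \<open>w s\<close> and \<open>h s\<close> are the value of the object and the
  ghost bit of the process at point \<open>s\<close>.\<close>

fun caller_past ::
  "(('u pc \<Rightarrow> 'u mem_resp \<Rightarrow> bool) \<Rightarrow> nat set) \<Rightarrow> (nat \<Rightarrow> 'u) \<Rightarrow> (nat \<Rightarrow> bool) \<Rightarrow> 'u caller \<Rightarrow> bool" where
  "caller_past X w h Direct \<longleftrightarrow> True"
| "caller_past X w h From_L1 \<longleftrightarrow> X reads_L3 = {} \<and> X reads_L7 = {} \<and> X confirms_L7 = {}"
| "caller_past X w h (From_L10 v) \<longleftrightarrow> (\<exists>s. X reads_L3 = {s} \<and> w s = v) \<and> X confirms_L7 = {}"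
| "caller_past X w h (From_S5 r) \<longleftrightarrow> (\<exists>s. X cas_step = {s} \<and> h s = r)"
| "caller_past X w h From_V3 \<longleftrightarrow> (\<exists>s. X reads_V2 = {s} \<and> \<not> h s)"

fun past ::
  "(('u pc \<Rightarrow> 'u mem_resp \<Rightarrow> bool) \<Rightarrow> nat set) \<Rightarrow> (nat \<Rightarrow> 'u) \<Rightarrow> (nat \<Rightarrow> bool) \<Rightarrow> 'u pc \<Rightarrow> bool" where
  "past X w h L2 \<longleftrightarrow> X reads_L3 = {} \<and> X reads_L7 = {} \<and> X confirms_L7 = {}"
| "past X w h L3 \<longleftrightarrow> X reads_L3 = {} \<and> X reads_L7 = {} \<and> X confirms_L7 = {}"
| "past X w h (L6 v t) \<longleftrightarrow>
     (\<exists>s. X reads_L3 = {s} \<and> w s = v) \<and> X reads_L7 = {} \<and> X confirms_L7 = {}"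
| "past X w h (L7 v t) \<longleftrightarrow>
     (\<exists>s. X reads_L3 = {s} \<and> w s = v) \<and> X reads_L7 = {} \<and> X confirms_L7 = {}"
| "past X w h (L9 v t v') \<longleftrightarrow> (\<exists>s. X reads_L7 = {s} \<and> X confirms_L7 = {s} \<and> w s = v')"
| "past X w h S2 \<longleftrightarrow> X cas_step = {}"
| "past X w h (S3 g) \<longleftrightarrow> X cas_step = {}"
| "past X w h (S4 g) \<longleftrightarrow> X cas_step = {}"
| "past X w h (K2 f) \<longleftrightarrow> caller_past X w h f"
| "past X w h (K4 f) \<longleftrightarrow> caller_past X w h f"
| "past X w h (K5 f) \<longleftrightarrow> caller_past X w h f"
| "past X w h (K7 f v t) \<longleftrightarrow> caller_past X w h f"
| "past X w h (K8 f v t) \<longleftrightarrow> caller_past X w h f"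
| "past X w h (K9 f v t) \<longleftrightarrow> caller_past X w h f"
| "past X w h (K10 f v t) \<longleftrightarrow> caller_past X w h f"
| "past X w h (K11 f v t) \<longleftrightarrow> caller_past X w h f"
| "past X w h R1 \<longleftrightarrow> X reads_R1 = {}"
| "past X w h V2 \<longleftrightarrow> X reads_V2 = {}"

text \<open>\<open>c\<close> is the point of invocation, where calls that return in S1 or V1 are
  linearized. For an LL, the absence of a confirming L7 characterizes linearization at L3.\<close>

fun answered ::
  "(('u pc \<Rightarrow> 'u mem_resp \<Rightarrow> bool) \<Rightarrow> nat set) \<Rightarrow> (nat \<Rightarrow> 'u) \<Rightarrow> (nat \<Rightarrow> bool) \<Rightarrow> nat \<Rightarrow>
   'u op \<Rightarrow> exit \<Rightarrow> 'u resp \<Rightarrow> bool" where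
  "answered X w h c (LL i) x r \<longleftrightarrow>
     x \<in> {ret_L5, ret_L11} \<and> (\<exists>s. X reads_L3 = {s} \<and> r = Val (w s)) \<and> X confirms_L7 = {} \<or>
     x \<in> {ret_L8, ret_L9} \<and> (\<exists>s. X reads_L7 = {s} \<and> X confirms_L7 = {s} \<and> r = Val (w s))"
| "answered X w h c (SC i u) x r \<longleftrightarrow>
     x = ret_S1 \<and> X cas_step = {} \<and> \<not> h c \<and> r = Bool False \<or>
     x = ret_S6 \<and> (\<exists>s. X cas_step = {s} \<and> r = Bool (h s))"
| "answered X w h c (CL i) x r \<longleftrightarrow> r = Nothing"
| "answered X w h c (Read i) x r \<longleftrightarrow> (\<exists>s. X reads_R1 = {s} \<and> r = Val (w s))"
| "answered X w h c (VL i) x r \<longleftrightarrow>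
     x = ret_V1 \<and> \<not> h c \<and> r = Bool False \<or>
     x \<in> {ret_V2, ret_V4} \<and> (\<exists>s. X reads_V2 = {s} \<and> r = Bool (h s))"

text \<open>The step that fixes the result may precede an internal CL, so it is remembered as a
  singleton until the response. The local invariant matches the outcome of the deciding CAS and of
  V2 with the ghost bit.\<close>

lemma past_step:
  assumes "step n k a c d M y d' M' e" "cell_ok (objL M i) b (d i) (Some (a, c))" "i = obj a"
    "past X w h c" "w t = fst (objL M i)" "h t = b"
    "\<And>P. X' P = X P \<union> (if P c y then {t} else {})"
  shows "(\<forall>c'. e = Goto c' \<longrightarrow> past X' w h c') \<and> (\<forall>x r. e = Return x r \<longrightarrow> answered X' w h z a x r)"
  using assms(1-6)
  by (cases rule: step.cases)
    (auto simp: assms(7) call_CL_def cas_def rest_ok_def linked_ok_def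
      split: if_splits option.splits elim!: caller_ok.elims)

lemma past_start:
  assumes "start a d = (d', e)" "rest_ok l b (d i)" "i = obj a" "h z = b" "\<And>P. X P = {}"
  shows "(\<forall>c'. e = Goto c' \<longrightarrow> past X w h c') \<and> (\<forall>x r. e = Return x r \<longrightarrow> answered X w h z a x r)"
  using assms(1-4)
  by (cases a) (auto simp: assms(5) call_CL_def rest_ok_def split: if_splits option.splits)

text \<open>K10 changes only the tag. A CAS counted by \<open>succeeds\<close> belongs to an SC, so
  the partial \<open>case\<close> is evaluated only where it is defined.\<close>

lemma step_value:
  assumes "step n k a c d M y d' M' e" "cell_ok (objL M i) b (d i) (Some (a, c))" "i = obj a"
  shows "fst (objL M' j) = (if succeeds (Step c y) \<and> j = i then (case a of SC _ u \<Rightarrow> u) else fst (objL M j))"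
  using assms
  by (cases rule: step.cases) (auto simp: cas_def split: if_splits)

text \<open>If the bit is set, S3 succeeds on the linked pair or S4 on its untagged form; if it is
  clear, the tag makes both fail.\<close>

lemma step_kind:
  assumes "step n k a c d M y d' M' e" "cell_ok (objL M i) b (d i) (Some (a, c))" "i = obj a"
  shows "cas_step c y \<Longrightarrow> (\<exists>u. a = SC i u) \<and> (succeeds (Step c y) \<longleftrightarrow> b)"
    and "sets_bit (Step c y) \<Longrightarrow> a = LL i"
    and "is_L3 c \<Longrightarrow> sets_bit (Step c y)"
  using assms
  by (cases rule: step.cases; auto simp: cas_def rest_ok_def linked_ok_def split: if_splits option.splits)+

lemma cas_step_iff: "(\<lambda>l y. is_S3 l \<and> y = Bool_resp True \<or> is_S4 l) = (cas_step :: 'u pc \<Rightarrow> _)"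
proof (intro ext)
  fix l :: "'u pc" and y
  show "(is_S3 l \<and> y = Bool_resp True \<or> is_S4 l) = cas_step l y" by (cases l) auto
qed

lemma first_point_eq_Some:
  assumes "{t. P t} = {s}"
  shows "first_point P = Some s"
proof -
  have "P s" "\<And>t. P t \<Longrightarrow> t = s" using assms by auto
  then have "(LEAST t. P t) = s" by (blast intro: Least_equality)
  with \<open>P s\<close> show ?thesis by (auto simp: first_point_def)
qed

lemma first_point_SomeD:
  assumes "first_point P = Some s"
  shows "P s" "\<And>t. P t \<Longrightarrow> s \<le> t"
  using assms by (auto simp: first_point_def intro: LeastI Least_le split: if_splits)

text \<open>Both cases are needed, because an infinite execution may have infinitely many
  linearization points.\<close>

lemma ex_increasing_enumeration:
  fixes T :: "nat set"
  shows "\<exists>N f. bij_betw f {j. enat j < N} T \<and> (\<forall>i j. i < j \<and> enat j < N \<longrightarrow> f i < f j)"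
proof (cases "finite T")
  case True
  have "bij_betw (enumerate T) {j. enat j < enat (card T)} T"
    using finite_bij_enumerate[OF True] by (simp add: lessThan_def)
  moreover have "\<forall>i j. i < j \<and> enat j < enat (card T) \<longrightarrow> enumerate T i < enumerate T j"
    using True by (auto intro: finite_enumerate_mono)
  ultimately show ?thesis by blast
next
  case False
  have "bij_betw (enumerate T) {j. enat j < \<infinity>} T"
    using bij_enumerate[OF False] by simp
  moreover have "\<forall>i j. i < j \<and> enat j < \<infinity> \<longrightarrow> enumerate T i < enumerate T j"
    using False by (auto intro: enumerate_mono)
  ultimately show ?thesis by blast
qed

section \<open>Invariants and call histories along an execution\<close>

locale execution_run =
  fixes n m k :: nat and u :: "nat \<Rightarrow> 'u" and E :: "'u exec" and S :: "nat \<Rightarrow> 'u config"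
  assumes initial: "S 0 = initial u"
    and transitions: "enat t < len E \<Longrightarrow> transition n m k (S t) (ev E t) (S (Suc t))"
    and bounded: "enat t < len E \<Longrightarrow> card (outstanding E t) \<le> k"
begin

primrec ghost_bit :: "nat \<Rightarrow> nat \<Rightarrow> nat \<Rightarrow> bool" where
  "ghost_bit 0 = (\<lambda>_ _. False)"
| "ghost_bit (Suc t) = update_bits (ev E t) (ghost_bit t)"

text \<open>Only events before \<open>t\<close> count here, so the set is empty at \<open>0\<close>
  and belongs to the configuration \<open>S t\<close>, whereas \<open>outstanding\<close> includes
  the event at \<open>t\<close>.\<close>

definition outstanding_before :: "nat \<Rightarrow> (nat \<times> nat) set" where
  "outstanding_before t =
     {(p, i). \<exists>s<t. proc (ev E s) = p \<and> oper (ev E s) = LL i \<and> act (ev E s) = Invoke \<and>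
                \<not> (\<exists>r. s < r \<and> r < t \<and> ends_LL p i (ev E r))}"

lemma outstanding_before_Suc: "outstanding_before (Suc t) = outstanding E t"
  by (auto simp: outstanding_before_def outstanding_def less_Suc_eq_le)

lemma outstanding_before_update:
  "outstanding_before (Suc t) = update_outstanding (ev E t) (outstanding_before t)"
proof -
  have ends: "proc e = p \<and> obj (oper e) = i \<and> (\<nexists>j. oper e = LL j)" if "ends_LL p i e" for p i and e :: "'u event"
    using that by (auto simp: ends_LL_def)
  have "(p, i) \<in> outstanding_before (Suc t) \<longleftrightarrow>
      p = proc (ev E t) \<and> oper (ev E t) = LL i \<and> act (ev E t) = Invoke \<or>
      (p, i) \<in> outstanding_before t \<and> \<not> ends_LL p i (ev E t)" for p i
    by (auto simp: outstanding_before_def less_Suc_eq)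
  moreover have "(p, i) \<in> update_outstanding (ev E t) (outstanding_before t) \<longleftrightarrow>
      p = proc (ev E t) \<and> oper (ev E t) = LL i \<and> act (ev E t) = Invoke \<or>
      (p, i) \<in> outstanding_before t \<and> \<not> ends_LL p i (ev E t)" for p i
    using ends[of p i "ev E t"] ends[of "proc (ev E t)" "obj (oper (ev E t))" "ev E t"]
    by (auto simp: update_outstanding_def)
  ultimately show ?thesis by auto
qed

lemma config_ok:
  assumes "enat t \<le> len E"
  shows "cells_ok (ghost_bit t) (S t) \<and> tags_ok (ghost_bit t) (S t) \<and> resets_ok (ghost_bit t) (S t) \<and> counters_ok (S t) \<and>
    outstanding_ok n m (outstanding_before t) (S t)"
  using assms
proof (induction t)
  case 0
  have "outstanding_before 0 = {}" by (simp add: outstanding_before_def)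
  then show ?case
    by (simp add: initial initial_def cells_ok_def tags_ok_def resets_ok_def counters_ok_def outstanding_ok_def
        site_def rest_ok_def)
next
  case (Suc t)
  then have t: "enat t < len E" by (simp add: Suc_ile_eq)
  note IH = Suc.IH[OF order_less_imp_le[OF t]]
  \<comment> \<open>The assumed bound holds after each event, so before event \<open>t\<close> it
    comes from the preceding event, if there is one.\<close>
  have "card (outstanding_before t) \<le> k"
  proof (cases t)
    case 0
    then show ?thesis by (simp add: outstanding_before_def)
  next
    case (Suc s)
    then have "enat s < len E" using t by (metis lessI enat_ord_simps(2) order_less_trans)
    then show ?thesis using bounded Suc by (simp add: outstanding_before_Suc)
  qed
  then show ?case
    using IH transitions[OF t] unfolding ghost_bit.simps outstanding_before_update
    by (blast intro: cells_ok_transition tags_ok_transition resets_ok_transition counters_ok_transition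
        outstanding_ok_transition)
qed

lemma cell_ok_site:
  assumes "enat t \<le> len E"
  shows "cell_ok (objL (mem (S t)) i) (ghost_bit t p i) (dict (S t) p i) (site (S t) p i)"
  using config_ok[OF assms] by (simp add: cells_ok_def)

lemma at_step:
  assumes "enat t < len E" "act (ev E t) = Step c y"
  obtains d M f where "status (S t) (proc (ev E t)) = Some (oper (ev E t), c)"
    "step n k (oper (ev E t)) c (dict (S t) (proc (ev E t))) (mem (S t)) y d M f"
    "S (Suc t) = \<lparr>mem = M, dict = (dict (S t))(proc (ev E t) := d),
       status = (status (S t))(proc (ev E t) := status_of (oper (ev E t)) f)\<rparr>"
    "outcome (ev E t) = outcome_of f"
    "cell_ok (objL (mem (S t)) (obj (oper (ev E t)))) (ghost_bit t (proc (ev E t)) (obj (oper (ev E t))))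
      (dict (S t) (proc (ev E t)) (obj (oper (ev E t)))) (Some (oper (ev E t), c))"
  using transitions[OF assms(1)]
proof cases
  case (invocation p a d e)
  then show ?thesis using assms(2) by simp
next
  case (shared_step p a c' y' d M f)
  have "cell_ok (objL (mem (S t)) (obj a)) (ghost_bit t p (obj a)) (dict (S t) p (obj a)) (Some (a, c'))"
    using cell_ok_site[OF order_less_imp_le[OF assms(1)], of "obj a" p] shared_step(3)
    by (simp add: site_def)
  then show ?thesis using that shared_step assms(2) by simp
qed

lemma at_invocation:
  assumes "enat t < len E" "act (ev E t) = Invoke"
  obtains d f where "status (S t) (proc (ev E t)) = None"
    "start (oper (ev E t)) (dict (S t) (proc (ev E t))) = (d, f)"
    "S (Suc t) = (S t)\<lparr>dict := (dict (S t))(proc (ev E t) := d),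
       status := (status (S t))(proc (ev E t) := status_of (oper (ev E t)) f)\<rparr>"
    "outcome (ev E t) = outcome_of f"
    "rest_ok (objL (mem (S t)) (obj (oper (ev E t)))) (ghost_bit t (proc (ev E t)) (obj (oper (ev E t))))
      (dict (S t) (proc (ev E t)) (obj (oper (ev E t))))"
  using transitions[OF assms(1)]
proof cases
  case (invocation p a d e)
  have "rest_ok (objL (mem (S t)) (obj a)) (ghost_bit t p (obj a)) (dict (S t) p (obj a))"
    using cell_ok_site[OF order_less_imp_le[OF assms(1)], of "obj a" p] invocation(5)
    by (simp add: site_def)
  then show ?thesis using that invocation assms(2) by simp
next
  case (shared_step p a c' y' d M f)
  then show ?thesis using assms(2) by simp
qed

definition val :: "nat \<Rightarrow> nat \<Rightarrow> 'u" where
  "val t i = fst (objL (mem (S t)) i)"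

definition steps_before :: "nat \<Rightarrow> nat \<Rightarrow> ('u pc \<Rightarrow> 'u mem_resp \<Rightarrow> bool) \<Rightarrow> nat set" where
  "steps_before t c P = {s. s < t \<and> event_of E c s \<and> (\<exists>l y. act (ev E s) = Step l y \<and> P l y)}"

text \<open>The call of \<open>p\<close> invoked most recently before \<open>t\<close>; it may have
  responded already.\<close>

definition current :: "nat \<Rightarrow> nat \<Rightarrow> nat \<Rightarrow> bool" where
  "current p t c \<longleftrightarrow> c \<in> calls E \<and> c < t \<and> proc (ev E c) = p \<and>
     (\<forall>s. c < s \<and> s < t \<and> proc (ev E s) = p \<longrightarrow> act (ev E s) \<noteq> Invoke)"

lemma current_unique:
  assumes "current p t c" "current p t c'"
  shows "c = c'"
proof -
  have "\<not> a < b" if "current p t a" "current p t b" for a b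
    using that by (auto simp: current_def calls_def)
  from this[of c c'] this[of c' c] show ?thesis using assms by simp
qed

lemma current_event_of:
  assumes "c \<in> calls E"
  shows "event_of E c t \<longleftrightarrow> enat t < len E \<and> proc (ev E t) = proc (ev E c) \<and>
    (t = c \<or> act (ev E t) \<noteq> Invoke \<and> current (proc (ev E c)) t c)"
  using assms by (auto simp: event_of_def current_def calls_def le_less)

lemma current_Suc:
  assumes "current p t c" "proc (ev E t) \<noteq> p \<or> act (ev E t) \<noteq> Invoke"
  shows "current p (Suc t) c"
  using assms by (auto simp: current_def less_Suc_eq)

lemma current_invocation:
  assumes "c \<in> calls E"
  shows "current (proc (ev E c)) (Suc c) c"
  using assms by (auto simp: current_def)

lemma steps_before_Suc:
  "steps_before (Suc t) c P = steps_before t c P \<union>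
     {s. s = t \<and> event_of E c t \<and> (\<exists>l y. act (ev E t) = Step l y \<and> P l y)}"
  by (auto simp: steps_before_def less_Suc_eq)

definition history_ok :: "nat \<Rightarrow> nat \<Rightarrow> nat \<Rightarrow> 'u op \<Rightarrow> 'u pc \<Rightarrow> bool" where
  "history_ok t p c a l \<longleftrightarrow> current p t c \<and> oper (ev E c) = a \<and>
     (\<forall>s. s < t \<and> event_of E c s \<longrightarrow> outcome (ev E s) = None) \<and>
     past (steps_before t c) (\<lambda>s. val s (obj a)) (\<lambda>s. ghost_bit s p (obj a)) l"

definition result_ok :: "nat \<Rightarrow> nat \<Rightarrow> exit \<Rightarrow> 'u resp \<Rightarrow> bool" where
  "result_ok t c x r \<longleftrightarrow> c \<in> calls E \<and>
     (\<forall>s. s < t \<and> event_of E c s \<longrightarrow> outcome (ev E s) = None) \<and>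
     answered (steps_before (Suc t) c) (\<lambda>s. val s (obj (oper (ev E c))))
       (\<lambda>s. ghost_bit s (proc (ev E c)) (obj (oper (ev E c)))) c (oper (ev E c)) x r"

lemma history_invocation:
  assumes "enat t < len E" "act (ev E t) = Invoke"
  shows "status (S (Suc t)) (proc (ev E t)) = Some (a, l) \<Longrightarrow> history_ok (Suc t) (proc (ev E t)) t a l"
    and "outcome (ev E t) = Some (x, r) \<Longrightarrow> result_ok t t x r"
proof -
  let ?a = "oper (ev E t)" and ?p = "proc (ev E t)"
  obtain d f where f: "start ?a (dict (S t) ?p) = (d, f)"
      "S (Suc t) = (S t)\<lparr>dict := (dict (S t))(?p := d), status := (status (S t))(?p := status_of ?a f)\<rparr>"
      "outcome (ev E t) = outcome_of f"
      "rest_ok (objL (mem (S t)) (obj ?a)) (ghost_bit t ?p (obj ?a)) (dict (S t) ?p (obj ?a))"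
    using at_invocation[OF assms] by metis
  have c: "t \<in> calls E" using assms by (simp add: calls_def)
  have "steps_before (Suc t) t P = {}" for P
    using assms by (auto simp: steps_before_def event_of_def less_Suc_eq)
  note past = past_start[OF f(1) f(4) refl, of "\<lambda>s. ghost_bit s ?p (obj ?a)" t "steps_before (Suc t) t"
      "\<lambda>s. val s (obj ?a)", OF refl this]
  have no: "outcome (ev E s) = None" if "s < t" "event_of E t s" for s
    using that by (simp add: event_of_def)
  show "history_ok (Suc t) ?p t a l" if "status (S (Suc t)) ?p = Some (a, l)"
  proof -
    have "f = Goto l" "a = ?a" using that f(2) by (cases f; simp)+
    moreover from this have "outcome (ev E t) = None" using f(3) by simp
    ultimately show ?thesis
      using past no current_invocation[OF c] by (auto simp: history_ok_def less_Suc_eq)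
  qed
  show "result_ok t t x r" if "outcome (ev E t) = Some (x, r)"
  proof -
    have "f = Return x r" using that f(3) by (cases f) simp_all
    then show ?thesis using past no c by (auto simp: result_ok_def)
  qed
qed

lemma history_step:
  assumes "enat t < len E" "act (ev E t) = Step l y" "history_ok t (proc (ev E t)) c (oper (ev E t)) l"
  shows "status (S (Suc t)) (proc (ev E t)) = Some (a, l') \<Longrightarrow> history_ok (Suc t) (proc (ev E t)) c a l'"
    and "outcome (ev E t) = Some (x, r) \<Longrightarrow> result_ok t c x r"
proof -
  let ?a = "oper (ev E t)" and ?p = "proc (ev E t)"
  obtain d M f where f: "step n k ?a l (dict (S t) ?p) (mem (S t)) y d M f"
      "S (Suc t) = \<lparr>mem = M, dict = (dict (S t))(?p := d), status = (status (S t))(?p := status_of ?a f)\<rparr>"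
      "outcome (ev E t) = outcome_of f"
      "cell_ok (objL (mem (S t)) (obj ?a)) (ghost_bit t ?p (obj ?a)) (dict (S t) ?p (obj ?a)) (Some (?a, l))"
    using at_step[OF assms(1,2)] by metis
  have h: "current ?p t c" "oper (ev E c) = ?a" "\<And>s. s < t \<Longrightarrow> event_of E c s \<Longrightarrow> outcome (ev E s) = None"
      "past (steps_before t c) (\<lambda>s. val s (obj ?a)) (\<lambda>s. ghost_bit s ?p (obj ?a)) l"
    using assms(3) by (auto simp: history_ok_def)
  have c: "c \<in> calls E" "proc (ev E c) = ?p" using h(1) by (auto simp: current_def)
  have e: "event_of E c t" using current_event_of[OF c(1)] assms h(1) c(2) by simp
  have "steps_before (Suc t) c P = steps_before t c P \<union> (if P l y then {t} else {})" for P
    using e assms(2) by (auto simp: steps_before_Suc)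
  note past = past_step[OF f(1) f(4) refl h(4), of t, OF _ refl this, where z = c, unfolded val_def, OF refl]
  show "history_ok (Suc t) ?p c a l'" if "status (S (Suc t)) ?p = Some (a, l')"
  proof -
    have "f = Goto l'" "a = ?a" using that f(2) by (cases f; simp)+
    moreover from this have "outcome (ev E t) = None" using f(3) by simp
    ultimately show ?thesis
      using past h current_Suc[OF h(1)] assms(2) by (auto simp: history_ok_def val_def less_Suc_eq)
  qed
  show "result_ok t c x r" if "outcome (ev E t) = Some (x, r)"
  proof -
    have "f = Return x r" using that f(3) by (cases f) simp_all
    then show ?thesis using past h c by (auto simp: result_ok_def val_def)
  qed
qed

text \<open>The control state does not record which call is pending; induction over time recovers
  the call and the steps that it has made.\<close>

lemma history:
  assumes "enat t \<le> len E" "status (S t) p = Some (a, l)"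
  shows "\<exists>c. history_ok t p c a l"
  using assms
proof (induction t arbitrary: a l)
  case 0
  then show ?case by (simp add: initial initial_def)
next
  case (Suc t)
  then have t: "enat t < len E" by (simp add: Suc_ile_eq)
  note IH = Suc.IH[OF order_less_imp_le[OF t]]
  show ?case
  proof (cases "p = proc (ev E t)")
    case True
    show ?thesis
    proof (cases "act (ev E t)")
      case Invoke
      then show ?thesis using history_invocation(1)[OF t] Suc.prems True by blast
    next
      case (Step l' y)
      then have "status (S t) p = Some (oper (ev E t), l')"
        using at_step[OF t Step] True by metis
      then obtain c where "history_ok t p c (oper (ev E t)) l'" using IH by blast
      then show ?thesis using history_step(1)[OF t Step] True Suc.prems by blast
    qed
  next
    case False
    from transitions[OF t] have "status (S (Suc t)) p = status (S t) p"
      by cases (use False in auto)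
    then have "status (S t) p = Some (a, l)" using Suc.prems by simp
    then obtain c where c: "history_ok t p c a l" using IH by blast
    have "\<not> event_of E c t" using c False by (auto simp: history_ok_def current_def event_of_def)
    then have "steps_before (Suc t) c P = steps_before t c P" for P
      by (auto simp: steps_before_Suc)
    then have "steps_before (Suc t) c = steps_before t c" by auto
    moreover have "current p (Suc t) c"
      using current_Suc c False unfolding history_ok_def by blast
    ultimately have "history_ok (Suc t) p c a l"
      using c \<open>\<not> event_of E c t\<close> by (auto simp: history_ok_def less_Suc_eq)
    then show ?thesis by blast
  qed
qed

lemma event_history:
  assumes "c \<in> calls E" "event_of E c t" "t \<noteq> c"
  obtains l y where "act (ev E t) = Step l y" "history_ok t (proc (ev E t)) c (oper (ev E t)) l"
proof -
  have t: "enat t < len E" "proc (ev E t) = proc (ev E c)" "act (ev E t) \<noteq> Invoke" "current (proc (ev E c)) t c"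
    using current_event_of[OF assms(1)] assms by auto
  then obtain l y where l: "act (ev E t) = Step l y" by (cases "act (ev E t)") auto
  then have "status (S t) (proc (ev E t)) = Some (oper (ev E t), l)"
    using at_step[OF t(1)] by metis
  then obtain c' where c': "history_ok t (proc (ev E t)) c' (oper (ev E t)) l"
    using history order_less_imp_le[OF t(1)] by blast
  then have "c' = c" using current_unique t by (auto simp: history_ok_def)
  then show ?thesis using that l c' by blast
qed

lemma event_oper:
  assumes "c \<in> calls E" "event_of E c t"
  shows "oper (ev E t) = oper (ev E c)" "proc (ev E t) = proc (ev E c)"
proof -
  show "oper (ev E t) = oper (ev E c)"
  proof (cases "t = c")
    case False
    then show ?thesis using event_history[OF assms] by (metis history_ok_def)
  qed simp
  show "proc (ev E t) = proc (ev E c)" using assms(2) by (simp add: event_of_def)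
qed

text \<open>At a later event the call would still be pending, and the history of a pending call
  contains no outcome.\<close>

lemma no_event_after_outcome:
  assumes "c \<in> calls E" "event_of E c t" "outcome (ev E t) \<noteq> None" "event_of E c s"
  shows "s \<le> t"
proof (rule ccontr)
  assume "\<not> s \<le> t"
  moreover have "c \<le> t" using assms(2) by (simp add: event_of_def)
  ultimately have "s \<noteq> c" "t < s" by auto
  then show False using event_history[OF assms(1,4)] assms(2,3) by (metis history_ok_def)
qed

lemma response_cases:
  assumes "c \<in> calls E" "response E c = Some (x, r)"
  obtains t where "response_point E c = Some t" "event_of E c t" "result_ok t c x r"
    "\<And>s. event_of E c s \<Longrightarrow> s \<le> t" "outcome (ev E t) = Some (x, r)"
proof -
  obtain t where t: "response_point E c = Some t" "outcome (ev E t) = Some (x, r)"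
    using assms(2) by (auto simp: response_def split: option.splits)
  then have e: "event_of E c t"
    using first_point_SomeD(1) unfolding response_point_def by blast
  have "result_ok t c x r"
  proof (cases "t = c")
    case True
    then show ?thesis using history_invocation(2) assms(1) t(2) by (simp add: calls_def)
  next
    case False
    from event_history[OF assms(1) e this] obtain l y where
      "act (ev E t) = Step l y" "history_ok t (proc (ev E t)) c (oper (ev E t)) l" .
    then show ?thesis using history_step(2) t(2) e by (simp add: event_of_def)
  qed
  then show ?thesis using that t e no_event_after_outcome[OF assms(1) e] by simp
qed

lemma response_outcome:
  assumes "c \<in> calls E" "event_of E c t" "outcome (ev E t) = Some (x, r)"
  shows "response E c = Some (x, r)"
proof -
  have "{s. event_of E c s \<and> outcome (ev E s) \<noteq> None} = {t}"
  proof -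
    have "s = t" if "event_of E c s" "outcome (ev E s) \<noteq> None" for s
      using no_event_after_outcome[OF assms(1,2) _ that(1)] no_event_after_outcome[OF assms(1) that assms(2)]
        assms(3) by simp
    moreover have "outcome (ev E t) \<noteq> None" using assms(3) by simp
    ultimately show ?thesis using assms(2) by blast
  qed
  then show ?thesis
    using assms(3) by (simp add: response_def response_point_def first_point_eq_Some)
qed

lemma step_point_eq_Some:
  assumes "steps_before (Suc t) c P = {s}" "\<And>s. event_of E c s \<Longrightarrow> s \<le> t"
  shows "step_point E c P = Some s"
proof -
  have "{t. event_of E c t \<and> (\<exists>l y. act (ev E t) = Step l y \<and> P l y)} = steps_before (Suc t) c P"
    using assms(2) by (auto simp: steps_before_def less_Suc_eq_le)
  then show ?thesis unfolding step_point_def using assms(1) by (intro first_point_eq_Some) simp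
qed

lemma step_point_SomeD:
  assumes "step_point E c P = Some s"
  shows "event_of E c s" "\<exists>l y. act (ev E s) = Step l y \<and> P l y"
  using first_point_SomeD(1)[OF assms[unfolded step_point_def]] by auto

lemma lin_event_of:
  assumes "c \<in> calls E" "lin E c = Some t"
  shows "event_of E c t"
proof -
  have "event_of E c c" using assms(1) by (auto simp: event_of_def calls_def)
  then show ?thesis
    using assms(2) step_point_SomeD(1)
    by (auto simp: lin_def split: op.splits option.splits if_splits prod.splits)
qed

definition impl_state :: "nat \<Rightarrow> nat \<Rightarrow> 'u llsc" where
  "impl_state t i = (val t i, \<lambda>p. ghost_bit t p i)"

text \<open>\<open>answered\<close> identifies the single step that \<open>lin\<close> selects and
  ties the response to the value and the ghost bit at that point.\<close>

lemma lin_response: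
  assumes "c \<in> calls E" "response E c = Some (x, r)"
  shows "\<exists>t. lin E c = Some t \<and> snd (spec_step (proc (ev E c)) (oper (ev E c)) (impl_state t)) = r"
proof -
  obtain t where t: "response_point E c = Some t" "event_of E c t" "result_ok t c x r"
    "\<And>s. event_of E c s \<Longrightarrow> s \<le> t" "outcome (ev E t) = Some (x, r)"
    using response_cases[OF assms] by blast
  let ?X = "steps_before (Suc t) c"
  have X: "step_point E c P = Some s" if "?X P = {s}" for P s
    using step_point_eq_Some[OF that t(4)] .
  show ?thesis
  proof (cases "oper (ev E c)")
    case (LL i)
    then show ?thesis using t(3) assms(2) X by (auto simp: result_ok_def lin_def impl_state_def)
  next
    case (SC i v)
    then show ?thesis using t(3) assms(2) X
      by (auto simp: result_ok_def lin_def impl_state_def cas_step_iff)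
  next
    case (CL i)
    then show ?thesis using t(3) by (auto simp: result_ok_def lin_def)
  next
    case (Read i)
    then show ?thesis using t(3) X by (auto simp: result_ok_def lin_def impl_state_def)
  next
    case (VL i)
    then show ?thesis using t(3) assms(2) X by (auto simp: result_ok_def lin_def impl_state_def)
  qed
qed

section \<open>The state of the specification\<close>

definition linearizes :: "nat \<Rightarrow> bool" where
  "linearizes t \<longleftrightarrow> (\<exists>c\<in>calls E. lin E c = Some t)"

lemma linearizes_less_len:
  assumes "linearizes t"
  shows "enat t < len E"
  using assms lin_event_of unfolding linearizes_def event_of_def by blast

lemma step_history:
  assumes "enat t < len E" "act (ev E t) = Step l y"
  obtains c where "c \<in> calls E" "event_of E c t" "history_ok t (proc (ev E t)) c (oper (ev E t)) l"
proof -
  have "status (S t) (proc (ev E t)) = Some (oper (ev E t), l)"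
    using at_step[OF assms] by metis
  then obtain c where c: "history_ok t (proc (ev E t)) c (oper (ev E t)) l"
    using history order_less_imp_le[OF assms(1)] by blast
  then have "c \<in> calls E" "proc (ev E c) = proc (ev E t)" by (auto simp: history_ok_def current_def)
  moreover from this have "event_of E c t"
    using c assms by (simp add: current_event_of history_ok_def)
  ultimately show ?thesis using that c by blast
qed

lemma event_step_kind:
  assumes "enat t < len E" "act (ev E t) = Step l y"
  shows "cas_step l y \<Longrightarrow> (\<exists>v. oper (ev E t) = SC (obj (oper (ev E t))) v) \<and>
      (succeeds (act (ev E t)) \<longleftrightarrow> ghost_bit t (proc (ev E t)) (obj (oper (ev E t))))"
    and "sets_bit (Step l y) \<Longrightarrow> \<exists>i. oper (ev E t) = LL i"
    and "is_L3 l \<Longrightarrow> sets_bit (Step l y)"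
proof -
  obtain d M f where f:
    "step n k (oper (ev E t)) l (dict (S t) (proc (ev E t))) (mem (S t)) y d M f"
    "cell_ok (objL (mem (S t)) (obj (oper (ev E t)))) (ghost_bit t (proc (ev E t)) (obj (oper (ev E t))))
      (dict (S t) (proc (ev E t)) (obj (oper (ev E t)))) (Some (oper (ev E t), l))"
    using at_step[OF assms] by metis
  note kind = step_kind[OF f refl]
  show "cas_step l y \<Longrightarrow> (\<exists>v. oper (ev E t) = SC (obj (oper (ev E t))) v) \<and>
      (succeeds (act (ev E t)) \<longleftrightarrow> ghost_bit t (proc (ev E t)) (obj (oper (ev E t))))"
    using kind(1) unfolding assms(2) by blast
  show "sets_bit (Step l y) \<Longrightarrow> \<exists>i. oper (ev E t) = LL i" using kind(2) by blast
  show "is_L3 l \<Longrightarrow> sets_bit (Step l y)" by (rule kind(3))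
qed

lemma event_value:
  assumes "enat t < len E"
  shows "val (Suc t) j = (if succeeds (act (ev E t)) \<and> j = obj (oper (ev E t))
    then (case oper (ev E t) of SC _ x \<Rightarrow> x) else val t j)"
proof (cases "act (ev E t)")
  case Invoke
  then show ?thesis using at_invocation[OF assms Invoke] by (fastforce simp: val_def)
next
  case (Step l y)
  obtain d M f where f:
    "step n k (oper (ev E t)) l (dict (S t) (proc (ev E t))) (mem (S t)) y d M f"
    "mem (S (Suc t)) = M"
    "cell_ok (objL (mem (S t)) (obj (oper (ev E t)))) (ghost_bit t (proc (ev E t)) (obj (oper (ev E t))))
      (dict (S t) (proc (ev E t)) (obj (oper (ev E t)))) (Some (oper (ev E t), l))"
    using at_step[OF assms Step] by (metis config.select_convs(1))
  show ?thesis using step_value[OF f(1,3) refl] f(2) Step by (simp only: val_def)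
qed

text \<open>This includes a pending SC, whose effect may already be visible to others. No deciding
  CAS precedes \<open>t\<close> in the call, and a call that returns in S1 makes none.\<close>

lemma cas_linearizes:
  assumes "enat t < len E" "act (ev E t) = Step l y" "cas_step l y"
  shows "linearizes t"
proof -
  obtain c where c: "c \<in> calls E" "event_of E c t" "history_ok t (proc (ev E t)) c (oper (ev E t)) l"
    using step_history[OF assms(1,2)] by blast
  have past: "steps_before t c cas_step = {}"
    using c(3) assms(3) by (cases l) (auto simp: history_ok_def)
  obtain i v where op: "oper (ev E c) = SC i v"
    using event_step_kind(1)[OF assms] event_oper[OF c(1,2)] by metis
  have "x \<noteq> ret_S1" if response: "response E c = Some (x, r)" for x r
  proof
    assume "x = ret_S1"
    obtain s where s: "result_ok s c x r" "t \<le> s" using response_cases[OF c(1) response] c(2) by metis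
    then have "steps_before (Suc s) c cas_step = {}" using op \<open>x = ret_S1\<close> by (auto simp: result_ok_def)
    moreover have "t \<in> steps_before (Suc s) c cas_step"
      using s(2) c(2) assms(2,3) by (auto simp: steps_before_def)
    ultimately show False by blast
  qed
  then have "lin E c = step_point E c cas_step"
    using op by (auto simp: lin_def cas_step_iff)
  also have "\<dots> = Some t"
  proof -
    let ?P = "\<lambda>t. event_of E c t \<and> (\<exists>l y. act (ev E t) = Step l y \<and> cas_step l y)"
    have "?P t" using c(2) assms(2,3) by blast
    moreover have "t \<le> s" if "?P s" for s
    proof (rule ccontr)
      assume "\<not> t \<le> s"
      then have "s \<in> steps_before t c cas_step" using that by (simp add: steps_before_def)
      then show False using past by blast
    qed
    ultimately have "(LEAST t. ?P t) = t" by (rule Least_equality)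
    with \<open>?P t\<close> show ?thesis unfolding step_point_def first_point_def by auto
  qed
  finally show ?thesis using c(1) by (auto simp: linearizes_def)
qed

text \<open>A return in S1 requires a clear bit, and at a deciding CAS the bit determines
  success.\<close>

lemma linearizes_SC:
  assumes "linearizes t" "oper (ev E t) = SC i v" "ghost_bit t (proc (ev E t)) i"
  shows "succeeds (act (ev E t))"
proof -
  obtain c where c: "c \<in> calls E" "lin E c = Some t" using assms(1) by (auto simp: linearizes_def)
  note e = lin_event_of[OF c]
  have op: "oper (ev E c) = SC i v" "proc (ev E c) = proc (ev E t)"
    using event_oper[OF c(1) e] assms(2) by simp_all
  show ?thesis
  proof (cases "\<exists>r. response E c = Some (ret_S1, r)")
    case True
    then obtain r where r: "response E c = Some (ret_S1, r)" by blast
    then have "t = c" using c(2) op by (simp add: lin_def)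
    obtain s where "result_ok s c ret_S1 r" using response_cases[OF c(1) r] by metis
    then have "\<not> ghost_bit c (proc (ev E c)) i" using op(1) by (simp add: result_ok_def)
    then have "\<not> ghost_bit t (proc (ev E t)) i" using \<open>t = c\<close> by simp
    then show ?thesis using assms(3) by simp
  next
    case False
    then have "step_point E c cas_step = Some t"
      using c(2) op by (simp add: lin_def cas_step_iff)
    then obtain l y where l: "act (ev E t) = Step l y" "cas_step l y"
      using step_point_SomeD(2) by blast
    then show ?thesis
      using event_step_kind(1)[OF linearizes_less_len[OF assms(1)] l] assms(2,3) by simp
  qed
qed

lemma linearizes_LL:
  assumes "linearizes t" "oper (ev E t) = LL i"
  shows "sets_bit (act (ev E t))"
proof -
  obtain c where c: "c \<in> calls E" "lin E c = Some t" using assms(1) by (auto simp: linearizes_def)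
  note e = lin_event_of[OF c]
  have op: "oper (ev E c) = LL i"
    using event_oper[OF c(1) e] assms(2) by simp
  obtain x r where r: "response E c = Some (x, r)"
    using c(2) op by (auto simp: lin_def split: option.splits)
  obtain s where s: "result_ok s c x r" "t \<le> s" using response_cases[OF c(1) r] e by metis
  show ?thesis
  proof (cases "x \<in> {ret_L5, ret_L11}")
    case True
    then have "step_point E c reads_L3 = Some t" using c(2) op r by (simp add: lin_def)
    then obtain l y where "act (ev E t) = Step l y" "is_L3 l" using step_point_SomeD(2) by blast
    then show ?thesis using event_step_kind(3)[OF linearizes_less_len[OF assms(1)]] by simp
  next
    case False
    then have L7: "step_point E c reads_L7 = Some t" using c(2) op r by (simp add: lin_def)
    then have "t \<in> steps_before (Suc s) c reads_L7"
      using step_point_SomeD(2)[OF L7] e s(2) by (auto simp: steps_before_def)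
    moreover have "steps_before (Suc s) c reads_L7 = steps_before (Suc s) c confirms_L7"
      using s(1) op False by (auto simp: result_ok_def)
    ultimately have "t \<in> steps_before (Suc s) c confirms_L7" by blast
    then show ?thesis unfolding steps_before_def by force
  qed
qed

text \<open>If L3 is the linearization point, no L7 of the call confirms; otherwise L7 is, and it is
  executed once and after L3. So a bit cleared by an SC after the linearization is not set again by
  the same LL.\<close>

lemma sets_bit_before_lin:
  assumes "act (ev E t) = Step l y" "sets_bit (Step l y)" "c \<in> calls E" "event_of E c t"
    "history_ok t (proc (ev E t)) c (oper (ev E t)) l" "lin E c = Some s"
  shows "t \<le> s"
proof -
  have t: "enat t < len E" using assms(4) by (simp add: event_of_def)
  obtain i where op: "oper (ev E c) = LL i"
    using event_step_kind(2)[OF t assms(1,2)] event_oper[OF assms(3,4)] by auto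
  obtain x r where r: "response E c = Some (x, r)"
    using assms(6) op by (auto simp: lin_def split: option.splits)
  obtain z where z: "result_ok z c x r" "t \<le> z" "s \<le> z"
    using response_cases[OF assms(3) r] assms(4) lin_event_of[OF assms(3,6)] by metis
  have mem: "t \<in> steps_before (Suc z) c P" if "P l y" for P
    using that z(2) assms(1,4) by (auto simp: steps_before_def)
  have l: "is_L3 l \<or> is_L7 l" using assms(2) by (cases l) auto
  show ?thesis
  proof (cases "x \<in> {ret_L5, ret_L11}")
    case True
    then have "step_point E c reads_L3 = Some s" using assms(6) op r by (simp add: lin_def)
    then have "s \<in> steps_before (Suc z) c reads_L3"
      using step_point_SomeD z(3) by (fastforce simp: steps_before_def)
    moreover have "steps_before (Suc z) c confirms_L7 = {}" "\<exists>s. steps_before (Suc z) c reads_L3 = {s}"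
      using z(1) op True by (auto simp: result_ok_def)
    ultimately show ?thesis using l mem[of reads_L3] mem[of confirms_L7] assms(2) by auto
  next
    case False
    then have "step_point E c reads_L7 = Some s" using assms(6) op r by (simp add: lin_def)
    note s = step_point_SomeD[OF this]
    then have "s \<in> steps_before (Suc z) c reads_L7"
      using z(3) by (fastforce simp: steps_before_def)
    moreover have "\<exists>s. steps_before (Suc z) c reads_L7 = {s}"
      using z(1) op False by (auto simp: result_ok_def)
    moreover have "t \<le> s" if "is_L3 l"
    proof (rule ccontr)
      assume "\<not> t \<le> s"
      then have "s \<in> steps_before t c reads_L7" using s by (simp add: steps_before_def)
      moreover have "steps_before t c reads_L7 = {}"
        using assms(5) that by (cases l) (auto simp: history_ok_def)
      ultimately show False by blast
    qed
    ultimately show ?thesis using l mem[of reads_L7] by auto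
  qed
qed

text \<open>Indexing by points of the execution, not by positions in the linearization, allows a
  comparison with the ghost bits by induction over time.\<close>

primrec spec_state :: "nat \<Rightarrow> nat \<Rightarrow> 'u llsc" where
  "spec_state 0 = (\<lambda>i. (u i, \<lambda>_. False))"
| "spec_state (Suc t) =
     (if linearizes t then fst (spec_step (proc (ev E t)) (oper (ev E t)) (spec_state t)) else spec_state t)"

text \<open>A pending LL makes the bit of its process unreliable until the linearization point of this LL,
  which depends on the future.\<close>

definition settled :: "nat \<Rightarrow> nat \<Rightarrow> nat \<Rightarrow> bool" where
  "settled t p i \<longleftrightarrow> (\<forall>l. status (S t) p = Some (LL i, l) \<longrightarrow>
     (\<exists>c s. current p t c \<and> lin E c = Some s \<and> s < t))"

lemma status_at:
  assumes "enat t < len E"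
  shows "status (S t) (proc (ev E t)) = (case act (ev E t) of Invoke \<Rightarrow> None | Step l y \<Rightarrow> Some (oper (ev E t), l))"
  using at_invocation[OF assms] at_step[OF assms] by (metis action.exhaust action.simps(4,5))

text \<open>The process is idle before an invocation and otherwise busy with another operation.
  Hence bits are reliable wherever a response depends on them.\<close>

lemma settled_not_LL:
  assumes "enat t < len E" "oper (ev E t) \<noteq> LL i"
  shows "settled t (proc (ev E t)) i"
  using assms by (auto simp: settled_def status_at split: action.splits)

lemma settled_other:
  assumes t: "enat t < len E" and "settled (Suc t) q j" "q \<noteq> proc (ev E t)"
  shows "settled t q j"
  unfolding settled_def
proof (intro allI impI)
  fix l assume l: "status (S t) q = Some (LL j, l)"
  have "status (S (Suc t)) q = status (S t) q"
    using transitions[OF t] by cases (use assms(3) in auto)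
  then obtain c s where c: "current q (Suc t) c" "lin E c = Some s" "s < Suc t"
    using assms(2) l by (auto simp: settled_def)
  obtain c' where "current q t c'"
    using history[OF order_less_imp_le[OF t] l] by (auto simp: history_ok_def)
  moreover from this have "current q (Suc t) c'" using current_Suc assms(3) by blast
  ultimately have cur: "current q t c" using current_unique c(1) by blast
  then have "event_of E c s" using lin_event_of c(2) by (simp add: current_def)
  then have "s \<noteq> t" using assms(3) cur by (auto simp: event_of_def current_def)
  then show "\<exists>c s. current q t c \<and> lin E c = Some s \<and> s < t"
    using cur c by auto
qed

text \<open>If the call continues, it is the current call to which \<open>settled\<close> refers; if
  it responds at \<open>t\<close>, the response itself makes \<open>lin\<close> defined, at a point
  that is not later.\<close>

lemma settled_lin:
  assumes t: "enat t < len E" and st: "act (ev E t) = Step l y" and op: "oper (ev E t) = LL i"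
    and c: "c \<in> calls E" "event_of E c t" "history_ok t (proc (ev E t)) c (oper (ev E t)) l"
    and settled: "settled (Suc t) (proc (ev E t)) i"
  shows "\<exists>s\<le>t. lin E c = Some s"
proof -
  obtain d M f where f:
    "S (Suc t) = \<lparr>mem = M, dict = (dict (S t))(proc (ev E t) := d),
       status = (status (S t))(proc (ev E t) := status_of (oper (ev E t)) f)\<rparr>"
    "outcome (ev E t) = outcome_of f"
    using at_step[OF t st] by metis
  show ?thesis
  proof (cases f)
    case (Goto l')
    then obtain c' s where c': "current (proc (ev E t)) (Suc t) c'" "lin E c' = Some s" "s < Suc t"
      using settled f(1) op by (auto simp: settled_def)
    have "current (proc (ev E t)) (Suc t) c"
      using current_Suc c(3) st unfolding history_ok_def by auto
    then have "c' = c" using c'(1) current_unique by blast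
    then show ?thesis using c' by auto
  next
    case (Return x r)
    then have "response E c = Some (x, r)" using response_outcome[OF c(1,2)] f(2) by simp
    then obtain s where s: "lin E c = Some s" using lin_response[OF c(1)] by blast
    have "s \<le> t"
      using no_event_after_outcome[OF c(1,2) _ lin_event_of[OF c(1) s]] f(2) Return by simp
    then show ?thesis using s by blast
  qed
qed

lemma linearizes_CL:
  assumes "enat t < len E" "oper (ev E t) = CL i"
  shows "linearizes t \<longleftrightarrow> act (ev E t) = Invoke"
proof
  assume "linearizes t"
  then obtain c where c: "c \<in> calls E" "lin E c = Some t" by (auto simp: linearizes_def)
  moreover from this have "oper (ev E c) = CL i"
    using event_oper[OF c(1) lin_event_of[OF c]] assms(2) by simp
  ultimately have "t = c" by (simp add: lin_def)
  then show "act (ev E t) = Invoke" using c(1) by (simp add: calls_def)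
next
  assume "act (ev E t) = Invoke"
  then have "t \<in> calls E" using assms(1) by (simp add: calls_def)
  then show "linearizes t"
    unfolding linearizes_def by (rule bexI[rotated]) (simp add: lin_def assms(2))
qed

lemma event_actions:
  assumes "enat t < len E"
  shows "succeeds (act (ev E t)) \<Longrightarrow> linearizes t \<and> (\<exists>i v. oper (ev E t) = SC i v \<and> ghost_bit t (proc (ev E t)) i)"
    and "sets_bit (act (ev E t)) \<Longrightarrow> \<exists>i. oper (ev E t) = LL i"
proof -
  assume s: "succeeds (act (ev E t))"
  then obtain l y where l: "act (ev E t) = Step l y" by (cases "act (ev E t)") auto
  then have "cas_step l y" using s by auto
  then show "linearizes t \<and> (\<exists>i v. oper (ev E t) = SC i v \<and> ghost_bit t (proc (ev E t)) i)"
    using cas_linearizes[OF assms l] event_step_kind(1)[OF assms l] s by metis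
next
  assume s: "sets_bit (act (ev E t))"
  then obtain l y where l: "act (ev E t) = Step l y" by (cases "act (ev E t)") auto
  then show "\<exists>i. oper (ev E t) = LL i" using event_step_kind(2)[OF assms l] s by simp
qed

lemma spec_state_value:
  assumes "enat t < len E" "\<And>p i. settled t p i \<Longrightarrow> snd (spec_state t i) p = ghost_bit t p i"
    "\<And>i. fst (spec_state t i) = val t i"
  shows "fst (spec_state (Suc t) j) = val (Suc t) j"
proof (cases "linearizes t")
  case True
  show ?thesis
  proof (cases "oper (ev E t)")
    case (SC i v)
    have "snd (spec_state t i) (proc (ev E t)) = succeeds (act (ev E t))"
      using assms(2)[OF settled_not_LL[OF assms(1)], of i] linearizes_SC[OF True SC]
        event_actions(1)[OF assms(1)] SC by auto
    then show ?thesis using True SC assms(3) event_value[OF assms(1), of j] by auto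
  qed (use True assms(3) event_value[OF assms(1), of j] event_actions(1)[OF assms(1)] in auto)
next
  case False
  then have "\<not> succeeds (act (ev E t))" using event_actions(1)[OF assms(1)] by blast
  then show ?thesis using False assms(3) event_value[OF assms(1), of j] by simp
qed

text \<open>Only the cell of an LL in progress is delicate. At its linearization point both bits
  become set. At any other of its steps after which it is settled, it was linearized earlier, so the
  step sets no bit and the process was settled before.\<close>

lemma spec_state_bit:
  assumes IH: "\<And>p i. settled t p i \<Longrightarrow> snd (spec_state t i) p = ghost_bit t p i"
    and t: "enat t < len E" and s: "settled (Suc t) q j"
  shows "snd (spec_state (Suc t) j) q = ghost_bit (Suc t) q j"
proof -
  let ?a = "oper (ev E t)" and ?p = "proc (ev E t)"
  note acts = event_actions[OF t]
  show ?thesis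
  proof (cases "\<exists>i. ?a = LL i")
    case False
    have "settled t q j"
      using settled_other[OF t s] settled_not_LL[OF t, of j] False by blast
    note q = IH[OF this]
    have no: "\<not> sets_bit (act (ev E t))" using acts(2) False by blast
    show ?thesis
    proof (cases ?a)
      case (SC i v)
      have "snd (spec_state t i) ?p = ghost_bit t ?p i"
        using IH settled_not_LL[OF t, of i] SC by simp
      then have "linearizes t \<and> snd (spec_state t i) ?p \<longleftrightarrow> succeeds (act (ev E t))"
        using linearizes_SC[of t i v] acts(1) SC by auto
      then show ?thesis using q no SC by (auto simp: update_bits_def)
    next
      case (CL i)
      then show ?thesis using q no acts(1) linearizes_CL[OF t CL] by (auto simp: update_bits_def)
    qed (use q no acts(1) False in \<open>auto simp: update_bits_def\<close>)
  next
    case True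
    then obtain i where LL: "?a = LL i" by blast
    have no: "\<not> succeeds (act (ev E t))" using acts(1) LL by auto
    show ?thesis
    proof (cases "(q, j) = (?p, i)")
      case False
      have "settled t q j"
        using settled_other[OF t s] settled_not_LL[OF t, of j] False LL by auto
      from IH[OF this] show ?thesis using False LL no by (auto simp: update_bits_def)
    next
      case qj: True
      show ?thesis
      proof (cases "linearizes t")
        case True
        then show ?thesis using linearizes_LL[OF True LL] qj LL no by (auto simp: update_bits_def)
      next
        case False
        have "\<not> sets_bit (act (ev E t)) \<and> settled t ?p i"
        proof (cases "act (ev E t)")
          case Invoke
          then show ?thesis using status_at[OF t] by (simp add: settled_def)
        next
          case (Step l y)
          obtain c where c: "c \<in> calls E" "event_of E c t" "history_ok t ?p c ?a l"
            using step_history[OF t Step] by blast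
          obtain z where z: "z \<le> t" "lin E c = Some z"
            using settled_lin[OF t Step LL c] s qj by auto
          have "z < t" using z False c(1) by (auto simp: linearizes_def le_less)
          moreover have "\<not> sets_bit (Step l y)"
            using sets_bit_before_lin[OF Step _ c z(2)] \<open>z < t\<close> by auto
          moreover have "current ?p t c" using c(3) by (simp add: history_ok_def)
          ultimately show ?thesis using z(2) Step unfolding settled_def by auto
        qed
        then show ?thesis using IH[of ?p i] False qj LL no by (auto simp: update_bits_def)
      qed
    qed
  qed
qed

lemma spec_state_ok:
  assumes "enat t \<le> len E"
  shows "(\<forall>i. fst (spec_state t i) = val t i) \<and> (\<forall>p i. settled t p i \<longrightarrow> snd (spec_state t i) p = ghost_bit t p i)"
  using assms
proof (induction t)
  case 0
  then show ?case by (simp add: val_def initial initial_def)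
next
  case (Suc t)
  then have t: "enat t < len E" by (simp add: Suc_ile_eq)
  note IH = Suc.IH[OF order_less_imp_le[OF t]]
  show ?case
    using spec_state_value[OF t] spec_state_bit[OF _ t] IH by blast
qed

text \<open>The answers to LL and Read depend only on the value, and those to SC and VL on a bit
  that is settled at that point.\<close>

lemma spec_state_response:
  assumes "c \<in> calls E" "response E c = Some (x, r)" "lin E c = Some t"
  shows "snd (spec_step (proc (ev E c)) (oper (ev E c)) (spec_state t)) = r"
proof -
  note e = lin_event_of[OF assms(1,3)]
  note op = event_oper[OF assms(1) e]
  have t: "enat t < len E" using e by (simp add: event_of_def)
  note ok = spec_state_ok[OF order_less_imp_le[OF t]]
  have "snd (spec_step (proc (ev E t)) (oper (ev E t)) (spec_state t)) =
      snd (spec_step (proc (ev E t)) (oper (ev E t)) (impl_state t))"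
    using ok settled_not_LL[OF t] by (cases "oper (ev E t)") (auto simp: impl_state_def)
  then show ?thesis using lin_response[OF assms(1,2)] assms(3) op by auto
qed

section \<open>Assembling the linearization\<close>

lemma spec_state_constant:
  assumes "s \<le> t" "\<And>z. s \<le> z \<Longrightarrow> z < t \<Longrightarrow> \<not> linearizes z"
  shows "spec_state t = spec_state s"
  using assms by (induction t rule: dec_induct) auto

text \<open>Linearization points are events of their calls, and an event belongs to only one
  call.\<close>

lemma linearizing_call_unique:
  assumes "c \<in> calls E" "c' \<in> calls E" "lin E c = Some t" "lin E c' = Some t"
  shows "c = c'"
proof -
  note e = lin_event_of[OF assms(1,3)] lin_event_of[OF assms(2,4)]
  have False if "c < c'" "c \<in> calls E" "c' \<in> calls E" "event_of E c t" "event_of E c' t" for c c'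
    using that by (auto simp: event_of_def calls_def)
  from this[of c c'] this[of c' c] show ?thesis using assms e by (metis linorder_neqE_nat)
qed

theorem linearizable: "\<exists>N f r. ordered_by_lin E N f \<and> linearization u E N f r"
proof -
  let ?A = "{c \<in> calls E. lin E c \<noteq> None}"
  obtain N g where g: "bij_betw g {j. enat j < N} {t. linearizes t}"
      "\<And>i j. i < j \<Longrightarrow> enat j < N \<Longrightarrow> g i < g j"
    using ex_increasing_enumeration by blast
  have lin_bij: "bij_betw (\<lambda>c. the (lin E c)) ?A {t. linearizes t}"
    unfolding bij_betw_def linearizes_def
    using linearizing_call_unique by (auto simp: inj_on_def image_iff) (metis option.sel)+
  define h where "h = inv_into ?A (\<lambda>c. the (lin E c))"
  have h: "bij_betw h {t. linearizes t} ?A"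
    unfolding h_def by (rule bij_betw_inv_into[OF lin_bij])
  have the_lin: "the (lin E (h t)) = t" if "linearizes t" for t
    unfolding h_def using bij_betw_inv_into_right[OF lin_bij] that by simp
  define f where "f j = h (g j)" for j
  \<comment> \<open>The specification determines all responses, including those of pending calls;
    \<open>spec_state_response\<close> shows that they match the actual ones.\<close>
  define r where "r j = snd (spec_step (proc (ev E (f j))) (oper (ev E (f j))) (spec_state (g j)))" for j
  have f: "bij_betw f {j. enat j < N} ?A"
    using bij_betw_trans[OF g(1) h] unfolding f_def comp_def .
  have f_mem: "f j \<in> calls E" "lin E (f j) = Some (g j)" "linearizes (g j)" if "enat j < N" for j
  proof -
    show lin: "linearizes (g j)" using bij_betwE[OF g(1)] that by blast
    then show "f j \<in> calls E" "lin E (f j) = Some (g j)"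
      using bij_betwE[OF f] that the_lin[OF lin] by (auto simp: f_def)
  qed
  have mono: "i < j" if "enat i < N" "enat j < N" "g i < g j" for i j
    using that g(2)[of j i] by (metis linorder_neqE_nat order_less_asym order_less_irrefl)
  have "ordered_by_lin E N f"
    unfolding ordered_by_lin_def
  proof (intro conjI allI impI, rule f, elim conjE)
    fix i j assume "i < j" "enat j < N"
    moreover from this have "enat i < N" by (meson enat_ord_simps(2) order_less_trans)
    ultimately show "the (lin E (f i)) < the (lin E (f j))" using f_mem g(2) by simp
  qed
  moreover have "linearization u E N f r"
    unfolding linearization_def
  proof (intro conjI allI impI)
    show "inj_on f {j. enat j < N}" using f by (simp add: bij_betw_def)
    show "f ` {j. enat j < N} \<subseteq> calls E" using f by (auto simp: bij_betw_def)
    show "{c \<in> calls E. response E c \<noteq> None} \<subseteq> f ` {j. enat j < N}"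
      using f lin_response by (fastforce simp: bij_betw_def)
    show "r j = v" if "enat j < N \<and> response E (f j) = Some (x, v)" for j x v
      using spec_state_response[of "f j" x v "g j"] f_mem[of j] that by (simp add: r_def)
    show "i < j" if *: "enat i < N \<and> enat j < N \<and> response_point E (f i) = Some t \<and> t < f j" for i j t
    proof -
      have t: "event_of E (f i) t" "outcome (ev E t) \<noteq> None"
        using first_point_SomeD(1)[of _ t] * unfolding response_point_def by blast+
      have "g i \<le> t"
        using no_event_after_outcome[OF f_mem(1) t] lin_event_of[OF f_mem(1,2)] * by blast
      moreover have "f j \<le> g j"
        using lin_event_of[OF f_mem(1,2)] * by (simp add: event_of_def)
      ultimately show ?thesis using mono * by simp
    qed
    \<comment> \<open>This is the state right after the previous linearization point. Using the
      state at \<open>g j\<close> would fail for the final state, as \<open>g\<close> carries no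
      information at the length \<open>N\<close>.\<close>
    define s where "s j = spec_state (case j of 0 \<Rightarrow> 0 | Suc i \<Rightarrow> Suc (g i))" for j
    have "s j = spec_state (g j)" if j: "enat j < N" for j
    proof -
      have no: "\<not> linearizes z" if "(case j of 0 \<Rightarrow> 0 | Suc i \<Rightarrow> Suc (g i)) \<le> z" "z < g j" for z
      proof
        assume "linearizes z"
        then obtain i where i: "enat i < N" "z = g i" using g(1) by (auto simp: bij_betw_def)
        then have "i < j" using mono j that by blast
        moreover have "j' < i" if "j = Suc j'" for j'
        proof (rule mono[OF _ i(1)])
          show "enat j' < N" using j that by (metis enat_ord_simps(2) lessI order_less_trans)
          show "g j' < g i" using i \<open>_ \<le> z\<close> that by simp
        qed
        ultimately show False by (cases j) auto
      qed
      have "(case j of 0 \<Rightarrow> 0 | Suc i \<Rightarrow> Suc (g i)) \<le> g j"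
        using g(2)[of "j - 1" j] j by (cases j) auto
      from spec_state_constant[OF this no] show ?thesis by (simp add: s_def)
    qed
    moreover have "proc (ev E (g j)) = proc (ev E (f j))" "oper (ev E (g j)) = oper (ev E (f j))"
      if "enat j < N" for j
      using event_oper[OF f_mem(1) lin_event_of[OF f_mem(1,2)]] that by auto
    ultimately have "spec_step (proc (ev E (f j))) (oper (ev E (f j))) (s j) = (s (Suc j), r j)"
      if "enat j < N" for j
      using f_mem(3)[OF that] that by (simp add: r_def prod_eq_iff) (simp add: s_def)
    moreover have "s 0 = (\<lambda>i. (u i, \<lambda>_. False))" by (simp add: s_def)
    ultimately show "consistent_with_spec u N (\<lambda>j. (proc (ev E (f j)), oper (ev E (f j)), r j))"
      unfolding consistent_with_spec_def by (intro exI[of _ s]) simp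
  qed
  ultimately show ?thesis by blast
qed

end

theorem theorem22:
  fixes n m k :: nat and u :: "nat \<Rightarrow> 'u" and E :: "'u exec"
  assumes "1 \<le> k"
    and "execution n m k u E"
    and "\<forall>t. enat t < len E \<longrightarrow> card (outstanding E t) \<le> k"
  shows "\<exists>N f r. ordered_by_lin E N f \<and> linearization u E N f r"
proof -
  obtain S where "S 0 = initial u" "\<forall>t. enat t < len E \<longrightarrow> transition n m k (S t) (ev E t) (S (Suc t))"
    using assms(2) by (auto simp: execution_def)
  then interpret execution_run n m k u E S
    using assms(3) by unfold_locales auto
  show ?thesis by (rule linearizable)
qed

end
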